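(* Let $(\boldsymbol\mu_n)_{n\ge1}$ be a sequence of i.i.d. random elements of $\mathcal{P}(\mathbb{R})$ with distribution $P_\mu$. If the Fréchet barycenter $\nu^*:=\operatorname{bar}(P_\mu)$ exists, then the sequence $\overline{\boldsymbol\mu}_n:=\operatorname{bar}(\boldsymbol\mu_i,1/n)_{1\le i\le n}$ of empirical Fréchet barycenters satisfies $$\lim_{n\to\infty}J(\overline{\boldsymbol\mu}_n,\nu^* )=\lim_{n\to\infty}J(\nu^*,\overline{\boldsymbol\mu}_n)=0\quad\text{almost surely}.$$
   Context: $g\colon\mathbb{R}\to\mathbb{R}$ is a strictly convex function that attains its minimum at $0$, with $g(0)=0$, and there exist constants $A,B\ge0$ such that $g(x-y)\le A+B(g(x)+g(y))$ for all $x,y\in\mathbb{R}$. $\mathcal{P}(\mathbb{R})$ is the set of Borel probability measures on $\mathbb{R}$ with the topology of weak convergence and its Borel $\sigma$-algebra; $P_\mu$ is a probability measure on this $\sigma$-algebra. For $\mu\in\mathcal{P}(\mathbb{R})$, $F_\mu(x)=\mu((-\infty,x))$ and the quantile function is $F_\mu^{-1}(y)=\inf\{x\colon F_\mu(x)\ge y\}$ for $0<y<1$. The transportation cost is $$J(\mu,\nu) := \inf_{\gamma\in\Pi(\mu,\nu)}\int_{\mathbb{R}\times\mathbb{R}} g(x-y)\,d\gamma(x,y) = \int_0^1 g\bigl(F_\mu^{-1}(x)-F_\nu^{-1}(x)\bigr)\,dx\in[0,+\infty],$$ where $\Pi(\mu,\nu)$ is the set of probability measures on $\mathbb{R}^2$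 with first marginal $\mu$ and second marginal $\nu$. For $\mu_1,\dots,\mu_n\in\mathcal{P}(\mathbb{R})$ and weights $\lambda_i>0$, the Fréchet barycenter $\operatorname{bar}(\mu_i,\lambda_i)_{1\le i\le n}$ is the minimizer of $\nu\mapsto\sum_{i=1}^n\lambda_iJ(\mu_i,\nu)$ over $\mathcal{P}(\mathbb{R})$, and $\operatorname{bar}(P_\mu)$ is the minimizer of $\nu\mapsto\int J(\mu,\nu)\,dP_\mu(\mu)$ over $\mathcal{P}(\mathbb{R})$. In both cases the barycenter is said to exist when the functional being minimized is finite for at least one $\nu\in\mathcal{P}(\mathbb{R})$ (it is then unique); if the functional is identically $+\infty$ there is no barycenter. In the present setting the empirical barycenters exist almost surely. *)

theory Defs
  imports "HOL-Probability.Probability"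
begin

definition strictly_convex_fun :: "(real \<Rightarrow> real) \<Rightarrow> bool" where
  "strictly_convex_fun g \<longleftrightarrow>
    (\<forall>x y t. x \<noteq> y \<longrightarrow> 0 < t \<longrightarrow> t < 1 \<longrightarrow>
      g ((1 - t) * x + t * y) < (1 - t) * g x + t * g y)"

definition borel_probs :: "real measure set" where
  "borel_probs = {\<mu>. prob_space \<mu> \<and> sets \<mu> = sets borel}"

text \<open>The coarsest topology on \<^const>\<open>borel_probs\<close> that makes every map
  \<open>\<mu> \<mapsto> \<integral> f d\<mu>\<close>, with \<open>f\<close> bounded and continuous, continuous.\<close>

definition weak_topology :: "real measure topology" where
  "weak_topology = topology_generated_by
    {{\<mu> \<in> borel_probs. (\<integral>x. f x \<partial>\<mu>) \<in> U} | (f :: real \<Rightarrow> real) U.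
      continuous_on UNIV f \<and> bounded (range f) \<and> open U}"

definition weak_borel :: "real measure measure" where
  "weak_borel = sigma (topspace weak_topology) {S. openin weak_topology S}"

lemma topspace_weak_topology [simp]: "topspace weak_topology = borel_probs"
proof -
  have "borel_probs \<in> {{\<mu> \<in> borel_probs. (\<integral>x. f x \<partial>\<mu>) \<in> U} | (f :: real \<Rightarrow> real) U.
      continuous_on UNIV f \<and> bounded (range f) \<and> open U}"
    by (rule CollectI, rule exI[of _ "\<lambda>_. 0"], rule exI[of _ UNIV]) auto
  then show ?thesis
    unfolding weak_topology_def topology_generated_by_topspace by blast
qed

lemma space_weak_borel [simp]: "space weak_borel = borel_probs"
  unfolding weak_borel_def by (simp add: space_measure_of_conv)

lemma sets_weak_borel: "sets weak_borel = sigma_sets borel_probs {S. openin weak_topology S}"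
  unfolding weak_borel_def
  by (subst sets_measure_of) (use openin_subset[of weak_topology] in auto)

definition couplings :: "real measure \<Rightarrow> real measure \<Rightarrow> (real \<times> real) measure set" where
  "couplings \<mu> \<nu> = {\<gamma>. prob_space \<gamma> \<and> sets \<gamma> = sets borel \<and>
    distr \<gamma> borel fst = \<mu> \<and> distr \<gamma> borel snd = \<nu>}"

definition transport_cost :: "(real \<Rightarrow> real) \<Rightarrow> real measure \<Rightarrow> real measure \<Rightarrow> ennreal" where
  "transport_cost g \<mu> \<nu> = (INF \<gamma>\<in>couplings \<mu> \<nu>. \<integral>\<^sup>+p. ennreal (g (fst p - snd p)) \<partial>\<gamma>)"

definition has_finite_value :: "(real measure \<Rightarrow> ennreal) \<Rightarrow> bool" where
  "has_finite_value \<Phi> \<longleftrightarrow> (\<exists>\<nu>\<in>borel_probs. \<Phi> \<nu> < \<infinity>)"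

text \<open>Minimizers are only considered at finite value, so the functional \<open>\<infinity>\<close> has none; the
  result is unspecified when there is no unique minimizer.\<close>

definition minimizer :: "(real measure \<Rightarrow> ennreal) \<Rightarrow> real measure" where
  "minimizer \<Phi> = (THE \<nu>. \<nu> \<in> borel_probs \<and> \<Phi> \<nu> < \<infinity> \<and> (\<forall>\<nu>'\<in>borel_probs. \<Phi> \<nu> \<le> \<Phi> \<nu>'))"

definition frechet_functional ::
    "(real \<Rightarrow> real) \<Rightarrow> real measure measure \<Rightarrow> real measure \<Rightarrow> ennreal" where
  "frechet_functional g P \<nu> = (\<integral>\<^sup>+\<mu>. transport_cost g \<mu> \<nu> \<partial>P)"

definition bar_exists :: "(real \<Rightarrow> real) \<Rightarrow> real measure measure \<Rightarrow> bool" where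
  "bar_exists g P \<longleftrightarrow> has_finite_value (frechet_functional g P)"

definition bar :: "(real \<Rightarrow> real) \<Rightarrow> real measure measure \<Rightarrow> real measure" where
  "bar g P = minimizer (frechet_functional g P)"

definition finite_bar ::
    "(real \<Rightarrow> real) \<Rightarrow> nat \<Rightarrow> (nat \<Rightarrow> real measure) \<Rightarrow> (nat \<Rightarrow> real) \<Rightarrow> real measure" where
  "finite_bar g n \<mu> w =
    minimizer (\<lambda>\<nu>. \<Sum>i = 1..n. ennreal (w i) * transport_cost g (\<mu> i) \<nu>)"

end

theory Submission
  imports Defs
begin

text \<open>
  On the line the optimal transport problem is solved by pairing equal quantiles: for the convex
  cost \<open>g\<close>, \<open>J(\<mu>, \<nu>) = \<integral>\<^sub>0\<^sup>1 g(Q\<^sub>\<mu>(t) - Q\<^sub>\<nu>(t)) dt\<close>, where \<open>Q\<close> denotes the quantile function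
  (\<open>transport_cost_eq_quantile\<close>). By Tonelli the barycenter functional then becomes
  \<open>\<nu> \<mapsto> \<integral>\<^sub>0\<^sup>1 \<phi>\<^sub>t(Q\<^sub>\<nu>(t)) dt\<close> with \<open>\<phi>\<^sub>t(x) = \<integral> g(Q\<^sub>\<mu>(t) - x) dP(\<mu>)\<close>, so it is minimized level by
  level: for almost every \<open>t\<close> the quantile of the barycenter is the unique minimizer of the
  strictly convex function \<open>\<phi>\<^sub>t\<close> (\<open>barycenter_quantiles\<close>). The same holds for the empirical
  barycenters, with the average \<open>\<phi>\<^bsub>n,t\<^esub>(x) = (1/n) \<Sum> g(Q\<^bsub>\<mu>\<^sub>i\<^esub>(t) - x)\<close> instead of \<open>\<phi>\<^sub>t\<close>.

  For a fixed level \<open>t\<close> the strong law of large numbers gives \<open>\<phi>\<^bsub>n,t\<^esub>(x) \<rightarrow> \<phi>\<^sub>t(x)\<close> almost surely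
  for all rational \<open>x\<close>. Minimizers of strictly convex functions are located by comparing values at
  rational points, so the minimizers converge as well: \<open>Q\<^bsub>\<nu>\<^sub>n\<^esub>(t) \<rightarrow> Q\<^bsub>\<nu>*\<^esub>(t)\<close>. Fubini turns
  "for almost every \<open>t\<close>, almost surely" into "almost surely, for almost every \<open>t\<close>".

  It remains to integrate this over \<open>t\<close>. The growth condition on \<open>g\<close> and the minimality of
  \<open>Q\<^bsub>\<nu>\<^sub>n\<^esub>(t)\<close> bound both \<open>g(Q\<^bsub>\<nu>\<^sub>n\<^esub>(t) - Q\<^bsub>\<nu>*\<^esub>(t))\<close> and \<open>g(Q\<^bsub>\<nu>*\<^esub>(t) - Q\<^bsub>\<nu>\<^sub>n\<^esub>(t))\<close> by
  \<open>A + 2 B \<phi>\<^bsub>n,t\<^esub>(Q\<^bsub>\<nu>*\<^esub>(t))\<close>. These bounds depend on \<open>n\<close>, but they converge pointwise by the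
  strong law, and their integrals \<open>A + 2 B (1/n) \<Sum> J(\<mu>\<^sub>i, \<nu>*)\<close> converge to the integral of the
  limit by the strong law for the integrable costs \<open>J(\<mu>\<^sub>i, \<nu>*)\<close>. Dominated convergence in this
  generalized form (\<open>nn_integral_tendsto_0_if_dominated\<close>) finishes the proof.

  The strong law itself (\<open>strong_law_of_large_numbers\<close>) rests on the maximal ergodic inequality:
  if the partial sums of an integrable i.i.d. sequence almost surely become positive, then its mean
  is nonnegative. By Kolmogorov's zero-one law, a sequence with negative mean therefore has partial
  sums that are almost surely bounded above.
\<close>

section \<open>Strictly convex functions on the line\<close>

lemma strictly_convex_funD:
  assumes "strictly_convex_fun f" "x \<noteq> y" "0 < t" "t < 1"
  shows "f ((1 - t) * x + t * y) < (1 - t) * f x + t * f y"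
  using assms unfolding strictly_convex_fun_def by blast

lemma strictly_convex_fun_convex_on:
  assumes "strictly_convex_fun f"
  shows "convex_on UNIV f"
proof (rule convex_onI)
  fix t x y :: real assume "0 < t" "t < 1"
  then show "f ((1 - t) *\<^sub>R x + t *\<^sub>R y) \<le> (1 - t) * f x + t * f y"
    using strictly_convex_funD[OF assms, of x y t] by (cases "x = y") (auto simp: algebra_simps)
qed auto

lemma strictly_convex_fun_continuous:
  assumes "strictly_convex_fun f"
  shows "continuous_on UNIV f"
  by (intro convex_on_continuous strictly_convex_fun_convex_on assms) auto

lemma strictly_convex_fun_measurable:
  "strictly_convex_fun f \<Longrightarrow> f \<in> borel_measurable borel"
  by (intro borel_measurable_continuous_onI strictly_convex_fun_continuous)

lemma strictly_convex_fun_reflect: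
  assumes "strictly_convex_fun f"
  shows "strictly_convex_fun (\<lambda>x. f (- x))"
  unfolding strictly_convex_fun_def
proof (intro allI impI)
  fix x y t :: real assume "x \<noteq> y" "0 < t" "t < 1"
  then show "f (- ((1 - t) * x + t * y)) < (1 - t) * f (- x) + t * f (- y)"
    using strictly_convex_funD[OF assms, of "-x" "-y" t] by (simp add: algebra_simps)
qed

text \<open>A point between \<open>x\<close> and the minimizer lies strictly below the chord, which itself stays below
  the value at \<open>x\<close>; hence \<open>f\<close> decreases strictly up to its minimizer.\<close>

lemma strictly_convex_less_left:
  assumes f: "strictly_convex_fun f" and min: "\<And>z. f b \<le> f z" and "x < y" "y \<le> b"
  shows "f y < f x"
proof (cases "y = b")
  case True
  have "f ((1 - 1/2) * x + 1/2 * b) < (1 - 1/2) * f x + 1/2 * f b"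
    using assms by (intro strictly_convex_funD) auto
  with min[of "(1 - 1/2) * x + 1/2 * b"] True show ?thesis by simp
next
  case False
  define t where "t = (y - x) / (b - x)"
  have t: "0 < t" "t < 1" using assms False by (auto simp: t_def field_simps)
  have "t * (b - x) = y - x" using assms by (simp add: t_def)
  then have "(1 - t) * x + t * b = y" by (simp add: algebra_simps)
  then have "f y < (1 - t) * f x + t * f b"
    using strictly_convex_funD[OF f, of x b t] t assms by auto
  also have "\<dots> \<le> (1 - t) * f x + t * f x"
    using min[of x] t by (intro add_left_mono mult_left_mono) auto
  finally show ?thesis by (simp add: algebra_simps)
qed

lemma strictly_convex_less_right:
  assumes f: "strictly_convex_fun f" and min: "\<And>z. f b \<le> f z" and "b \<le> x" "x < y"
  shows "f x < f y"
  using strictly_convex_less_left[OF strictly_convex_fun_reflect[OF f], of "- b" "- y" "- x"] assms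
  by auto

lemma strictly_convex_minimizer_unique:
  assumes f: "strictly_convex_fun f" and min: "\<And>z. f b \<le> f z" and "f c \<le> f b"
  shows "c = b"
  using strictly_convex_less_left[OF f min, of c b] strictly_convex_less_right[OF f min, of b c]
    assms(3) by (cases c b rule: linorder_cases) auto

lemma strictly_convex_minimizer_exists:
  assumes f: "strictly_convex_fun f" and bounded: "\<And>x. f x \<le> f 0 \<Longrightarrow> \<bar>x\<bar> \<le> K"
  shows "\<exists>b. \<forall>x. f b \<le> f x"
proof -
  have "0 \<le> K" using bounded[of 0] by simp
  have "\<exists>b\<in>{-K..K}. \<forall>x\<in>{-K..K}. f b \<le> f x"
    using \<open>0 \<le> K\<close> continuous_on_subset[OF strictly_convex_fun_continuous[OF f]]
    by (intro continuous_attains_inf) auto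
  then obtain b where b: "\<And>x. x \<in> {-K..K} \<Longrightarrow> f b \<le> f x" by blast
  have "f b \<le> f x" for x
    using b[of x] b[of 0] bounded[of x] \<open>0 \<le> K\<close> by (cases "f x \<le> f 0") (force simp: abs_le_iff)+
  then show ?thesis by blast
qed

text \<open>A strictly convex function decreases up to its minimizer and increases afterwards, so a smaller
  value to the left of \<open>x\<close> betrays that the minimizer lies there too. Measurability of minimizers
  follows, because they are located by countably many comparisons of function values.\<close>

lemma strictly_convex_minimizer_less_iff:
  assumes f: "strictly_convex_fun f" and min: "\<And>z. f b \<le> f z"
  shows "b < x \<longleftrightarrow> (\<exists>r\<in>\<rat>. r < x \<and> f r < f x)"
proof
  assume "b < x"
  then obtain r where "r \<in> \<rat>" "b < r" "r < x" using Rats_dense_in_real by blast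
  then show "\<exists>r\<in>\<rat>. r < x \<and> f r < f x"
    using strictly_convex_less_right[OF f min, of r x] by auto
next
  assume "\<exists>r\<in>\<rat>. r < x \<and> f r < f x"
  then obtain r where r: "r < x" "f r < f x" by blast
  show "b < x"
    using strictly_convex_less_left[OF f min, of r x] r by force
qed

lemma borel_measurable_minimizer:
  fixes F :: "'a \<Rightarrow> real \<Rightarrow> real"
  assumes meas [measurable]: "\<And>x. (\<lambda>t. F t x) \<in> borel_measurable N"
    and F: "\<And>t. t \<in> space N \<Longrightarrow> strictly_convex_fun (F t)"
    and min: "\<And>t x. t \<in> space N \<Longrightarrow> F t (b t) \<le> F t x"
  shows "b \<in> borel_measurable N"
proof (rule borel_measurableI_less)
  fix x :: real
  have "{t \<in> space N. b t < x} = {t \<in> space N. \<exists>r\<in>\<rat>. r < x \<and> F t r < F t x}"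
    using strictly_convex_minimizer_less_iff[OF F min] by auto
  also have "\<dots> \<in> sets N"
    by (intro sets.sets_Collect_countable_Ex' countable_rat) measurable
  finally show "{t \<in> space N. b t < x} \<in> sets N" .
qed

text \<open>If \<open>r < s < b\<close> then \<open>f s < f r\<close>, hence \<open>F n s < F n r\<close> eventually, which forces the minimizer
  of \<open>F n\<close> to the right of \<open>r\<close>; the other side is symmetric. Convergence at rational points
  suffices, so only countably many exceptional null sets arise when the values are random.\<close>

lemma strictly_convex_minimizers_converge:
  fixes F :: "nat \<Rightarrow> real \<Rightarrow> real"
  assumes f: "strictly_convex_fun f" and min: "\<And>x. f b \<le> f x"
    and F: "\<forall>\<^sub>F n in sequentially. strictly_convex_fun (F n)"
    and Fmin: "\<forall>\<^sub>F n in sequentially. \<forall>x. F n (c n) \<le> F n x"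
    and lim: "\<And>x. x \<in> \<rat> \<Longrightarrow> (\<lambda>n. F n x) \<longlonglongrightarrow> f x"
  shows "c \<longlonglongrightarrow> b"
proof (rule order_tendstoI)
  fix a assume "a < b"
  obtain r where r: "r \<in> \<rat>" "a < r" "r < b" using \<open>a < b\<close> Rats_dense_in_real by blast
  obtain s where s: "s \<in> \<rat>" "r < s" "s < b" using r Rats_dense_in_real by blast
  have "f s < f r" using strictly_convex_less_left[OF f min] r s by auto
  then have "\<forall>\<^sub>F n in sequentially. 0 < F n r - F n s"
    by (intro order_tendstoD(1)[OF tendsto_diff[OF lim[OF r(1)] lim[OF s(1)]]]) simp
  then show "\<forall>\<^sub>F n in sequentially. a < c n"
    using F Fmin
  proof eventually_elim
    case (elim n)
    then show ?case
      using strictly_convex_less_right[of "F n" "c n" r s] r s by force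
  qed
next
  fix a assume "b < a"
  obtain r where r: "r \<in> \<rat>" "b < r" "r < a" using \<open>b < a\<close> Rats_dense_in_real by blast
  obtain s where s: "s \<in> \<rat>" "b < s" "s < r" using r Rats_dense_in_real by blast
  have "f s < f r" using strictly_convex_less_right[OF f min] r s by auto
  then have "\<forall>\<^sub>F n in sequentially. 0 < F n r - F n s"
    by (intro order_tendstoD(1)[OF tendsto_diff[OF lim[OF r(1)] lim[OF s(1)]]]) simp
  then show "\<forall>\<^sub>F n in sequentially. c n < a"
    using F Fmin
  proof eventually_elim
    case (elim n)
    then show ?case
      using strictly_convex_less_left[of "F n" "c n" s r] r s by force
  qed
qed

section \<open>The strong law of large numbers\<close>

text \<open>The largest of the first partial sums, the empty one included:
  \<open>max_partial_sum n x = max\<^bsub>k \<le> n\<^esub> \<Sum>\<^bsub>i < k\<^esub> x i\<close>. The recursion through the shifted sequence is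
  what the maximal inequality below uses.\<close>

fun max_partial_sum :: "nat \<Rightarrow> (nat \<Rightarrow> real) \<Rightarrow> real" where
  "max_partial_sum 0 x = 0"
| "max_partial_sum (Suc n) x = max 0 (x 0 + max_partial_sum n (\<lambda>i. x (Suc i)))"

lemma max_partial_sum_nonneg: "0 \<le> max_partial_sum n x"
  by (cases n) auto

lemma max_partial_sum_mono: "max_partial_sum n x \<le> max_partial_sum (Suc n) x"
proof (induction n arbitrary: x)
  case (Suc n)
  show ?case using Suc[of "\<lambda>i. x (Suc i)"] by simp
qed simp

lemma sum_le_max_partial_sum: "(\<Sum>i<n. x i) \<le> max_partial_sum n x"
proof (induction n arbitrary: x)
  case (Suc n)
  show ?case using Suc[of "\<lambda>i. x (Suc i)"] unfolding sum.lessThan_Suc_shift by simp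
qed simp

lemma max_partial_sum_le: "max_partial_sum n x \<le> (\<Sum>i<n. \<bar>x i\<bar>)"
proof (induction n arbitrary: x)
  case (Suc n)
  show ?case using Suc[of "\<lambda>i. x (Suc i)"] max_partial_sum_nonneg[of n "\<lambda>i. x (Suc i)"]
    unfolding sum.lessThan_Suc_shift by simp
qed simp

lemma measurable_max_partial_sum [measurable (raw)]:
  fixes X :: "nat \<Rightarrow> 'a \<Rightarrow> real"
  assumes "\<And>i. X i \<in> borel_measurable N"
  shows "(\<lambda>\<omega>. max_partial_sum n (\<lambda>i. X i \<omega>)) \<in> borel_measurable N"
  using assms by (induction n arbitrary: X) (auto intro!: borel_measurable_max borel_measurable_add)

context prob_space
begin

lemma indep_vars_reindex:
  assumes inj: "inj_on h J" and indep: "indep_vars N X (h ` J)"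
  shows "indep_vars (\<lambda>j. N (h j)) (\<lambda>j. X (h j)) J"
  unfolding indep_vars_def2 indep_sets_def
proof (intro conjI ballI allI impI)
  show "X (h j) \<in> measurable M (N (h j))" if "j \<in> J" for j
    using indep that by (auto simp: indep_vars_def)
  show "{X (h j) -` S \<inter> space M |S. S \<in> sets (N (h j))} \<subseteq> events" if "j \<in> J" for j
    using indep that by (auto simp: indep_vars_def2 indep_sets_def)
next
  fix K S assume K: "K \<subseteq> J" "K \<noteq> {}" "finite K"
    and S: "S \<in> (\<Pi> j\<in>K. {X (h j) -` S \<inter> space M |S. S \<in> sets (N (h j))})"
  have inj': "inj_on h K" using inj K(1) inj_on_subset by blast
  have eq: "S (inv_into K h (h j)) = S j" if "j \<in> K" for j using that inj' by simp
  have "prob (\<Inter>i\<in>h ` K. S (inv_into K h i)) = (\<Prod>i\<in>h ` K. prob (S (inv_into K h i)))"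
    using indep K S eq unfolding indep_vars_def2
    by (intro indep_setsD[of "\<lambda>i. {X i -` S \<inter> space M |S. S \<in> sets (N i)}" "h ` J"]) auto
  then show "prob (\<Inter>j\<in>K. S j) = (\<Prod>j\<in>K. prob (S j))"
    using inj' eq by (simp add: prod.reindex cong: prod.cong)
qed

text \<open>Both sequences are distributed as the infinite power of the common law.\<close>

lemma iid_shift_distr:
  fixes X :: "nat \<Rightarrow> 'a \<Rightarrow> real"
  assumes indep: "indep_vars (\<lambda>_. borel) X UNIV" and D: "\<And>i. distr M borel (X i) = D"
  shows "distr M (PiM UNIV (\<lambda>_. borel)) (\<lambda>\<omega> i. X (Suc i) \<omega>)
    = distr M (PiM UNIV (\<lambda>_. borel)) (\<lambda>\<omega> i. X i \<omega>)"
proof -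
  have rv: "X i \<in> borel_measurable M" for i using indep by (auto simp: indep_vars_def)
  have "indep_vars (\<lambda>_. borel) (\<lambda>i. X (Suc i)) UNIV"
    using indep_vars_reindex[of Suc UNIV "\<lambda>_. borel" X] indep_vars_subset[OF indep, of "range Suc"]
    by simp
  from this[unfolded indep_vars_iff_distr_eq_PiM[OF UNIV_not_empty rv]]
    indep[unfolded indep_vars_iff_distr_eq_PiM[OF UNIV_not_empty rv]]
  show ?thesis by (simp add: D restrict_UNIV)
qed

text \<open>The maximal ergodic inequality. Write \<open>H n\<close> for the maximal partial sum and \<open>H' n\<close> for that of the
  shifted sequence. Where \<open>H (n + 1)\<close> is positive, it equals \<open>X 0 + H' n\<close>; elsewhere it is \<open>0 \<le> H' n\<close>.
  Therefore \<open>E[X 0; H (n + 1) > 0] \<ge> E[H (n + 1) - H' n] = E[H (n + 1) - H n] \<ge> 0\<close>, because the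
  shift preserves the law. Since
  some partial sum is almost surely positive, the events exhaust the space as \<open>n\<close> grows.\<close>

lemma iid_positive_partial_sum_mean_nonneg:
  fixes X :: "nat \<Rightarrow> 'a \<Rightarrow> real"
  assumes indep: "indep_vars (\<lambda>_. borel) X UNIV" and D: "\<And>i. distr M borel (X i) = D"
    and int: "integrable M (X 0)"
    and pos: "AE \<omega> in M. \<exists>n. 0 < (\<Sum>i<n. X i \<omega>)"
  shows "0 \<le> expectation (X 0)"
proof -
  have rv [measurable]: "X i \<in> borel_measurable M" for i using indep by (auto simp: indep_vars_def)
  have "integrable M (X i) \<longleftrightarrow> integrable D (\<lambda>x. x)" for i
    unfolding D[of i, symmetric] by (subst integrable_distr_eq) auto
  with int have intX: "integrable M (X i)" for i by simp
  define H where "H n \<omega> = max_partial_sum n (\<lambda>i. X i \<omega>)" for n \<omega>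
  define H' where "H' n \<omega> = max_partial_sum n (\<lambda>i. X (Suc i) \<omega>)" for n \<omega>
  have [measurable]: "H n \<in> borel_measurable M" "H' n \<in> borel_measurable M" for n
    unfolding H_def H'_def by measurable
  have intH: "integrable M (H n)" for n
    by (rule Bochner_Integration.integrable_bound[of _ "\<lambda>\<omega>. \<Sum>i<n. \<bar>X i \<omega>\<bar>"])
      (use intX max_partial_sum_nonneg max_partial_sum_le in
        \<open>auto simp: H_def abs_of_nonneg intro!: order_trans[OF max_partial_sum_le]\<close>)
  have intH': "integrable M (H' n)" for n
    by (rule Bochner_Integration.integrable_bound[of _ "\<lambda>\<omega>. \<Sum>i<n. \<bar>X (Suc i) \<omega>\<bar>"])
      (use intX max_partial_sum_nonneg max_partial_sum_le in
        \<open>auto simp: H'_def abs_of_nonneg intro!: order_trans[OF max_partial_sum_le]\<close>)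
  have same: "expectation (H' n) = expectation (H n)" for n
  proof -
    have "expectation (H n) =
        (\<integral>x. max_partial_sum n x \<partial>distr M (PiM UNIV (\<lambda>_. borel)) (\<lambda>\<omega> i. X i \<omega>))"
      unfolding H_def by (subst integral_distr) (auto intro!: measurable_PiM_single')
    also have "\<dots> = (\<integral>x. max_partial_sum n x \<partial>distr M (PiM UNIV (\<lambda>_. borel)) (\<lambda>\<omega> i. X (Suc i) \<omega>))"
      by (simp only: iid_shift_distr[OF indep D])
    also have "\<dots> = expectation (H' n)"
      unfolding H'_def by (subst integral_distr) (auto intro!: measurable_PiM_single')
    finally show ?thesis ..
  qed
  have step: "0 \<le> (\<integral>\<omega>. X 0 \<omega> * indicator {\<omega>. 0 < H (Suc n) \<omega>} \<omega> \<partial>M)" for n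
  proof -
    have "0 \<le> (\<integral>\<omega>. H (Suc n) \<omega> - H n \<omega> \<partial>M)"
      using max_partial_sum_mono by (intro Bochner_Integration.integral_nonneg) (auto simp: H_def simp del: max_partial_sum.simps)
    also have "\<dots> = (\<integral>\<omega>. H (Suc n) \<omega> - H' n \<omega> \<partial>M)"
      using intH intH' same by simp
    also have "\<dots> \<le> (\<integral>\<omega>. X 0 \<omega> * indicator {\<omega>. 0 < H (Suc n) \<omega>} \<omega> \<partial>M)"
    proof (rule integral_mono)
      show "integrable M (\<lambda>\<omega>. X 0 \<omega> * indicator {\<omega>. 0 < H (Suc n) \<omega>} \<omega>)"
        by (rule Bochner_Integration.integrable_bound[OF int]) (auto split: split_indicator)
      show "H (Suc n) \<omega> - H' n \<omega> \<le> X 0 \<omega> * indicator {\<omega>. 0 < H (Suc n) \<omega>} \<omega>" for \<omega>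
        using max_partial_sum_nonneg[of n "\<lambda>i. X (Suc i) \<omega>"]
        by (auto simp: H_def H'_def split: split_indicator)
    qed (use intH intH' in auto)
    finally show ?thesis .
  qed
  have "(\<lambda>n. \<integral>\<omega>. X 0 \<omega> * indicator {\<omega>. 0 < H (Suc n) \<omega>} \<omega> \<partial>M) \<longlonglongrightarrow> expectation (X 0)"
  proof (rule integral_dominated_convergence[where w="\<lambda>\<omega>. \<bar>X 0 \<omega>\<bar>"])
    show "AE \<omega> in M. (\<lambda>n. X 0 \<omega> * indicator {\<omega>. 0 < H (Suc n) \<omega>} \<omega>) \<longlonglongrightarrow> X 0 \<omega>"
      using pos
    proof eventually_elim
      case (elim \<omega>)
      then obtain n where n: "0 < (\<Sum>i<n. X i \<omega>)" by blast
      have "0 < H (Suc m) \<omega>" if "n \<le> m" for m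
      proof -
        have "H n \<omega> \<le> H (Suc m) \<omega>"
          unfolding H_def
          using incseqD[OF incseq_SucI[of "\<lambda>n. max_partial_sum n (\<lambda>i. X i \<omega>)"], of n "Suc m"]
            max_partial_sum_mono that by (simp del: max_partial_sum.simps)
        with n sum_le_max_partial_sum[of "\<lambda>i. X i \<omega>" n] show ?thesis by (simp add: H_def del: max_partial_sum.simps)
      qed
      then show ?case
        by (intro tendsto_eventually eventually_sequentiallyI[of n]) auto
    qed
  qed (use int in \<open>auto split: split_indicator\<close>)
  then show ?thesis by (rule LIMSEQ_le_const) (use step in blast)
qed

text \<open>Dropping the first \<open>m\<close> summands changes all later partial sums by the same finite amount, so
  unboundedness is a tail event and Kolmogorov's zero-one law applies.\<close>

lemma iid_unbounded_partial_sums_0_1: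
  fixes X :: "nat \<Rightarrow> 'a \<Rightarrow> real"
  assumes indep: "indep_vars (\<lambda>_. borel) X UNIV"
  defines "U \<equiv> {\<omega> \<in> space M. \<forall>K::nat. \<exists>n. real K < (\<Sum>i<n. X i \<omega>)}"
  shows "prob U = 0 \<or> prob U = 1"
proof -
  define F where "F i = sigma_sets (space M) {X i -` S \<inter> space M | S. S \<in> sets borel}" for i
  have "U \<in> sigma_sets (space M) (\<Union>(F ` {m..}))" for m
  proof -
    define N where "N = sigma (space M) (\<Union>(F ` {m..}))"
    have F_sub: "\<Union>(F ` {m..}) \<subseteq> Pow (space M)"
      unfolding F_def by (auto dest!: sigma_sets_into_sp[rotated])
    have [simp]: "space N = space M" "sets N = sigma_sets (space M) (\<Union>(F ` {m..}))"
      unfolding N_def using F_sub by (simp_all add: space_measure_of_conv sets_measure_of)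
    have X: "X i \<in> borel_measurable N" if "m \<le> i" for i
    proof (rule measurableI)
      fix S :: "real set" assume "S \<in> sets borel"
      then have "X i -` S \<inter> space M \<in> F i" unfolding F_def by (intro sigma_sets.Basic) auto
      then show "X i -` S \<inter> space N \<in> sets N" using that by (auto intro!: sigma_sets.Basic)
    qed simp
    have "(\<forall>K::nat. \<exists>n. real K < (\<Sum>i<n. x i)) \<longleftrightarrow> (\<forall>K::nat. \<exists>n. real K < (\<Sum>i=m..<n. x i))"
      for x :: "nat \<Rightarrow> real"
    proof (intro iffI allI)
      fix K :: nat assume *: "\<forall>K::nat. \<exists>n. real K < (\<Sum>i<n. x i)"
      obtain K' :: nat where K': "K + (\<Sum>i<m. \<bar>x i\<bar>) \<le> K'" using real_arch_simple by blast
      obtain n where n: "K' < (\<Sum>i<n. x i)" using * by blast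
      have "m \<le> n"
      proof (rule ccontr)
        assume "\<not> m \<le> n"
        then have "(\<Sum>i<n. x i) \<le> (\<Sum>i<m. \<bar>x i\<bar>)"
          by (intro order_trans[OF sum_mono sum_mono2]) auto
        with n K' show False by simp
      qed
      then have "(\<Sum>i<n. x i) = (\<Sum>i<m. x i) + (\<Sum>i=m..<n. x i)"
        using sum.atLeastLessThan_concat[of 0 m n x] by (simp add: lessThan_atLeast0)
      moreover have "(\<Sum>i<m. x i) \<le> (\<Sum>i<m. \<bar>x i\<bar>)" by (intro sum_mono) auto
      ultimately show "\<exists>n. real K < (\<Sum>i=m..<n. x i)" using n K' by (intro exI[of _ n]) linarith
    next
      fix K :: nat assume *: "\<forall>K::nat. \<exists>n. real K < (\<Sum>i=m..<n. x i)"
      obtain K' :: nat where K': "K - (\<Sum>i<m. x i) \<le> K'" using real_arch_simple by blast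
      obtain n where n: "K' < (\<Sum>i=m..<n. x i)" using * by blast
      then have "m \<le> n" by (cases "m \<le> n") auto
      then have "(\<Sum>i<n. x i) = (\<Sum>i<m. x i) + (\<Sum>i=m..<n. x i)"
        using sum.atLeastLessThan_concat[of 0 m n x] by (simp add: lessThan_atLeast0)
      then show "\<exists>n. real K < (\<Sum>i<n. x i)" using n K' by (intro exI[of _ n]) linarith
    qed
    then have "U = {\<omega> \<in> space N. \<forall>K::nat. \<exists>n. real K < (\<Sum>i=m..<n. X i \<omega>)}"
      by (simp add: U_def)
    also have "\<dots> \<in> sets N"
    proof -
      have [measurable]: "(\<lambda>\<omega>. \<Sum>i=m..<n. X i \<omega>) \<in> borel_measurable N" for n
        using X by (intro borel_measurable_sum) auto
      show ?thesis by measurable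
    qed
    finally show ?thesis by simp
  qed
  then have "U \<in> tail_events F" by (simp add: tail_events_def)
  moreover have "indep_sets F UNIV" using indep unfolding indep_vars_def F_def by auto
  moreover have "sigma_algebra (space M) (F i)" for i
    unfolding F_def by (intro sigma_algebra_sigma_sets) auto
  ultimately show ?thesis by (intro kolmogorov_0_1_law[of F])
qed

text \<open>If the partial sums were unbounded above with positive probability, then they would be so almost
  surely, and the maximal inequality would make the mean nonnegative.\<close>

lemma iid_negative_drift_bounded_above:
  fixes X :: "nat \<Rightarrow> 'a \<Rightarrow> real"
  assumes indep: "indep_vars (\<lambda>_. borel) X UNIV" and D: "\<And>i. distr M borel (X i) = D"
    and int: "integrable M (X 0)" and neg: "expectation (X 0) < 0"
  shows "AE \<omega> in M. \<exists>K::nat. \<forall>n. (\<Sum>i<n. X i \<omega>) \<le> real K"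
proof -
  have rv [measurable]: "X i \<in> borel_measurable M" for i using indep by (auto simp: indep_vars_def)
  define U where "U = {\<omega> \<in> space M. \<forall>K::nat. \<exists>n. real K < (\<Sum>i<n. X i \<omega>)}"
  have [measurable]: "U \<in> sets M" unfolding U_def by measurable
  have "prob U \<noteq> 1"
  proof
    assume "prob U = 1"
    then have "AE \<omega> in M. \<omega> \<in> U" by (subst (asm) prob_eq_1) auto
    then have "AE \<omega> in M. \<exists>n. 0 < (\<Sum>i<n. X i \<omega>)"
      by eventually_elim (auto simp: U_def dest!: spec[of _ "0::nat"])
    then show False using iid_positive_partial_sum_mean_nonneg[OF indep D int] neg by simp
  qed
  then have "prob U = 0" using iid_unbounded_partial_sums_0_1[OF indep] by (auto simp: U_def)
  then have "AE \<omega> in M. \<omega> \<notin> U" by (subst (asm) prob_eq_0) auto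
  then show ?thesis using AE_space by eventually_elim (auto simp: U_def not_less)
qed

text \<open>The sequences \<open>X i - E X - \<epsilon>\<close> and \<open>E X - X i - \<epsilon>\<close> have negative drift, so their partial sums are
  bounded above. This confines \<open>\<Sum>\<^bsub>i < n\<^esub> X i\<close> to \<open>n E X\<close> up to \<open>n \<epsilon>\<close> and a constant.\<close>

theorem strong_law_of_large_numbers:
  fixes X :: "nat \<Rightarrow> 'a \<Rightarrow> real"
  assumes indep: "indep_vars (\<lambda>_. borel) X UNIV" and D: "\<And>i. distr M borel (X i) = D"
    and int: "integrable M (X 0)"
  shows "AE \<omega> in M. (\<lambda>n. (\<Sum>i<n. X i \<omega>) / n) \<longlonglongrightarrow> expectation (X 0)"
proof -
  let ?m = "expectation (X 0)"
  have rv [measurable]: "X i \<in> borel_measurable M" for i using indep by (auto simp: indep_vars_def)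
  have bounded: "AE \<omega> in M. \<exists>K::nat. \<forall>n. (\<Sum>i<n. s * (X i \<omega> - ?m) - e) \<le> real K"
    if "0 < e" for s e :: real
  proof -
    define h where "h x = s * (x - ?m) - e" for x
    have [measurable]: "h \<in> borel_measurable borel" unfolding h_def by measurable
    have "indep_vars (\<lambda>_. borel) (\<lambda>i \<omega>. h (X i \<omega>)) UNIV"
      by (rule indep_vars_compose2[OF indep]) measurable
    moreover have "distr M borel (\<lambda>\<omega>. h (X i \<omega>)) = distr D borel h" for i
    proof -
      have "distr (distr M borel (X i)) borel h = distr M borel (h \<circ> X i)"
        by (rule distr_distr) measurable
      then show ?thesis by (simp only: D comp_def)
    qed
    moreover have "integrable M (\<lambda>\<omega>. h (X 0 \<omega>))" "expectation (\<lambda>\<omega>. h (X 0 \<omega>)) < 0"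
      unfolding h_def using int that by (auto simp: prob_space)
    ultimately show ?thesis
      unfolding h_def[symmetric] by (rule iid_negative_drift_bounded_above)
  qed
  have "AE \<omega> in M. \<forall>k::nat. (\<exists>K::nat. \<forall>n. (\<Sum>i<n. 1 * (X i \<omega> - ?m) - inverse (real (Suc k))) \<le> real K) \<and>
      (\<exists>K::nat. \<forall>n. (\<Sum>i<n. (-1) * (X i \<omega> - ?m) - inverse (real (Suc k))) \<le> real K)"
    unfolding AE_all_countable by (intro allI AE_conjI bounded) auto
  then show ?thesis
  proof eventually_elim
    case (elim \<omega>)
    show ?case
    proof (rule LIMSEQ_I)
      fix r :: real assume "0 < r"
      then obtain k :: nat where k: "inverse (real (Suc k)) < r / 2"
        using reals_Archimedean[of "r / 2"] by auto
      define e where "e = inverse (real (Suc k))"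
      \<comment> \<open>The two drift bounds, solved for the partial sums.\<close>
      obtain K L :: nat where K: "\<And>n. (\<Sum>i<n. X i \<omega>) \<le> real n * (?m + e) + K"
        and L: "\<And>n. real n * (?m - e) - L \<le> (\<Sum>i<n. X i \<omega>)"
        using elim[rule_format, of k] unfolding e_def[symmetric]
        by (auto simp: sum_subtractf sum_negf sum.distrib algebra_simps)
      obtain N :: nat where N: "2 * (real K + real L) / r < real N" using reals_Archimedean2 by blast
      have "norm ((\<Sum>i<n. X i \<omega>) / n - ?m) < r" if "n \<ge> Suc N" for n
      proof -
        have n: "0 < real n" using that by simp
        have "real N < real n" using that by simp
        with N have "2 * (real K + real L) / r < real n" by linarith
        then have b: "real K + real L < real n * (r / 2)"
          using \<open>0 < r\<close> by (simp add: field_simps)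
        have c: "real n * e < real n * (r / 2)" using k n by (simp add: e_def)
        have "\<bar>(\<Sum>i<n. X i \<omega>) - real n * ?m\<bar> < real n * r"
          using K[of n] L[of n] b c by (simp add: algebra_simps abs_less_iff)
        also have "(\<Sum>i<n. X i \<omega>) - real n * ?m = real n * ((\<Sum>i<n. X i \<omega>) / n - ?m)"
          using n by (simp add: field_simps)
        finally show ?thesis using n by (simp add: abs_mult)
      qed
      then show "\<exists>N. \<forall>n\<ge>N. norm ((\<Sum>i<n. X i \<omega>) / n - ?m) < r" by blast
    qed
  qed
qed

end

lemma (in prob_space) strong_law_for_observable:
  fixes Z :: "nat \<Rightarrow> 'a \<Rightarrow> 'b" and f :: "'b \<Rightarrow> real"
  assumes indep: "indep_vars (\<lambda>_. N) Z UNIV" and Z: "\<And>i. distr M N (Z i) = P"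
    and f [measurable]: "f \<in> borel_measurable N" and int: "integrable P f"
  shows "AE \<omega> in M. (\<lambda>n. (\<Sum>i<n. f (Z i \<omega>)) / n) \<longlonglongrightarrow> (\<integral>z. f z \<partial>P)"
proof -
  have rv [measurable]: "Z i \<in> measurable M N" for i using indep by (auto simp: indep_vars_def)
  have "AE \<omega> in M. (\<lambda>n. (\<Sum>i<n. f (Z i \<omega>)) / n) \<longlonglongrightarrow> expectation (\<lambda>\<omega>. f (Z 0 \<omega>))"
  proof (rule strong_law_of_large_numbers)
    show "indep_vars (\<lambda>_. borel) (\<lambda>i \<omega>. f (Z i \<omega>)) UNIV"
      by (rule indep_vars_compose2[OF indep]) measurable
    have "distr (distr M N (Z i)) borel f = distr M borel (f \<circ> Z i)" for i
      by (rule distr_distr) measurable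
    then show "distr M borel (\<lambda>\<omega>. f (Z i \<omega>)) = distr P borel f" for i
      by (simp only: Z comp_def)
    show "integrable M (\<lambda>\<omega>. f (Z 0 \<omega>))"
      using int unfolding Z[of 0, symmetric] by (subst (asm) integrable_distr_eq) auto
  qed
  also have "expectation (\<lambda>\<omega>. f (Z 0 \<omega>)) = (\<integral>z. f z \<partial>P)"
    unfolding Z[of 0, symmetric] by (subst integral_distr) auto
  finally show ?thesis .
qed

section \<open>Quantile functions\<close>

text \<open>For \<open>0 < t < 1\<close> this is also the infimum of \<open>{x. t \<le> \<mu> {..<x}}\<close>: the two sets can differ only
  in their left end point.\<close>

definition quantile :: "real measure \<Rightarrow> real \<Rightarrow> real" where
  "quantile \<mu> t = Inf {x. t \<le> cdf \<mu> x}"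

definition unit_lebesgue :: "real measure" where
  "unit_lebesgue = restrict_space lborel {0<..<1}"

lemma space_unit_lebesgue [simp]: "space unit_lebesgue = {0<..<1}"
  by (simp add: unit_lebesgue_def space_restrict_space)

lemma sets_unit_lebesgue [measurable_cong]:
  "sets unit_lebesgue = sets (restrict_space borel {0<..<1})"
  unfolding unit_lebesgue_def by (rule sets_restrict_space_cong) simp

lemma prob_space_unit_lebesgue: "prob_space unit_lebesgue"
  by (auto simp: unit_lebesgue_def emeasure_restrict_space space_restrict_space intro!: prob_spaceI)

lemma emeasure_unit_lebesgue_le:
  assumes "S \<subseteq> {a<..b}" "S \<in> sets unit_lebesgue"
  shows "emeasure unit_lebesgue S \<le> ennreal (b - a)"
proof -
  have "S \<subseteq> {0<..<1}" using sets.sets_into_space[OF assms(2)] by simp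
  then have "emeasure unit_lebesgue S = emeasure lborel S"
    unfolding unit_lebesgue_def by (intro emeasure_restrict_space) auto
  also have "\<dots> \<le> emeasure lborel {a<..b}" using assms by (intro emeasure_mono) auto
  also have "\<dots> \<le> ennreal (b - a)" by (cases "a \<le> b") auto
  finally show ?thesis .
qed

lemma borel_probs_cdf_distribution: "\<mu> \<in> borel_probs \<Longrightarrow> cdf_distribution \<mu>"
  by (simp add: borel_probs_def cdf_distribution_def real_distribution_def
      real_distribution_axioms_def)

lemma borel_probsD:
  assumes "\<mu> \<in> borel_probs"
  shows "prob_space \<mu>" "sets \<mu> = sets borel" "space \<mu> = UNIV"
  using assms sets_eq_imp_space_eq[of \<mu> borel] by (auto simp: borel_probs_def)

lemma quantile_le_iff:
  assumes "\<mu> \<in> borel_probs" "0 < t" "t < 1"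
  shows "quantile \<mu> t \<le> x \<longleftrightarrow> t \<le> cdf \<mu> x"
proof -
  interpret cdf_distribution \<mu> by (rule borel_probs_cdf_distribution[OF assms(1)])
  show ?thesis using pseudoinverse[OF assms(2,3), of x] by (simp add: quantile_def)
qed

lemma measurable_quantile1 [measurable]:
  assumes "\<mu> \<in> borel_probs"
  shows "quantile \<mu> \<in> borel_measurable unit_lebesgue"
proof -
  interpret cdf_distribution \<mu> by (rule borel_probs_cdf_distribution[OF assms(1)])
  show ?thesis using measurable_CI unfolding quantile_def[abs_def]
    by (simp cong: measurable_cong_sets add: sets_unit_lebesgue)
qed

lemma distr_quantile:
  assumes "\<mu> \<in> borel_probs"
  shows "distr unit_lebesgue borel (quantile \<mu>) = \<mu>"
proof -
  interpret cdf_distribution \<mu> by (rule borel_probs_cdf_distribution[OF assms(1)])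
  show ?thesis using distr_I_eq_M by (simp add: quantile_def[abs_def] unit_lebesgue_def)
qed

lemma measurable_integral_weak_borel:
  fixes f :: "real \<Rightarrow> real"
  assumes "continuous_on UNIV f" "bounded (range f)"
  shows "(\<lambda>\<mu>. \<integral>x. f x \<partial>\<mu>) \<in> borel_measurable weak_borel"
proof (rule borel_measurableI)
  fix S :: "real set" assume "open S"
  then have "openin weak_topology {\<mu> \<in> borel_probs. (\<integral>x. f x \<partial>\<mu>) \<in> S}"
    unfolding weak_topology_def using assms by (intro topology_generated_by_Basis) blast
  then have "{\<mu> \<in> borel_probs. (\<integral>x. f x \<partial>\<mu>) \<in> S} \<in> sets weak_borel"
    unfolding sets_weak_borel by (intro sigma_sets.Basic) simp
  then show "(\<lambda>\<mu>. \<integral>x. f x \<partial>\<mu>) -` S \<inter> space weak_borel \<in> sets weak_borel"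
    by (simp add: vimage_def Int_def conj_commute)
qed

text \<open>The indicator of \<open>{..x}\<close> is a decreasing limit of bounded continuous functions, and integration
  of such functions is measurable by the definition of the weak topology.\<close>

lemma measurable_cdf_weak_borel [measurable]:
  "(\<lambda>\<mu>. cdf \<mu> x) \<in> borel_measurable weak_borel"
proof (rule borel_measurable_LIMSEQ_real)
  define f where "f k y = max 0 (min 1 (1 - real k * (y - x)))" for k y
  have f: "\<bar>f k y\<bar> \<le> 1" for k y by (auto simp: f_def)
  have cont: "continuous_on UNIV (f k)" for k unfolding f_def by (intro continuous_intros)
  show "(\<lambda>\<mu>. \<integral>y. f k y \<partial>\<mu>) \<in> borel_measurable weak_borel" for k
    using f by (intro measurable_integral_weak_borel cont boundedI[of _ 1]) auto
  fix \<mu> assume "\<mu> \<in> space weak_borel"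
  then have \<mu>: "\<mu> \<in> borel_probs" by simp
  interpret prob_space \<mu> by (rule borel_probsD[OF \<mu>])
  have [measurable_cong]: "sets \<mu> = sets borel" by (rule borel_probsD[OF \<mu>])
  have lim: "(\<lambda>k. f k y) \<longlonglongrightarrow> indicator {..x} y" for y
  proof (cases "y \<le> x")
    case True
    then have "f k y = 1" for k
      by (simp add: f_def mult_le_0_iff)
    then show ?thesis using True by simp
  next
    case False
    obtain N :: nat where N: "1 / (y - x) < N" using reals_Archimedean2 by blast
    have "f k y = 0" if "N \<le> k" for k
    proof -
      have "1 < real N * (y - x)" using N False by (simp add: field_simps)
      also have "\<dots> \<le> real k * (y - x)" using that False by (intro mult_right_mono) auto
      finally show ?thesis by (simp add: f_def)
    qed
    then show ?thesis using False
      by (intro tendsto_eventually eventually_sequentiallyI[of N]) auto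
  qed
  have "(\<lambda>k. \<integral>y. f k y \<partial>\<mu>) \<longlonglongrightarrow> (\<integral>y. indicator {..x} y \<partial>\<mu>)"
  proof (rule integral_dominated_convergence[where w="\<lambda>_. 1"])
    show "f k \<in> borel_measurable \<mu>" for k
      using borel_measurable_continuous_onI[OF cont[of k]] by simp
  qed (use lim f in auto)
  also have "(\<integral>y. indicator {..x} y \<partial>\<mu>) = cdf \<mu> x"
    by (simp add: cdf_def borel_probsD[OF \<mu>])
  finally show "(\<lambda>k. \<integral>y. f k y \<partial>\<mu>) \<longlonglongrightarrow> cdf \<mu> x" .
qed

lemma measurable_quantile_pair:
  "(\<lambda>p. quantile (fst p) (snd p)) \<in> borel_measurable (weak_borel \<Otimes>\<^sub>M unit_lebesgue)"
proof (rule borel_measurableI_le)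
  fix x
  have [measurable]: "(\<lambda>t. t) \<in> borel_measurable unit_lebesgue"
    by (simp add: measurable_cong_sets[OF sets_unit_lebesgue refl] measurable_restrict_space1)
  have "{p \<in> space (weak_borel \<Otimes>\<^sub>M unit_lebesgue). quantile (fst p) (snd p) \<le> x}
      = {p \<in> space (weak_borel \<Otimes>\<^sub>M unit_lebesgue). snd p \<le> cdf (fst p) x}"
    by (auto simp: space_pair_measure quantile_le_iff)
  also have "\<dots> \<in> sets (weak_borel \<Otimes>\<^sub>M unit_lebesgue)"
    by measurable
  finally show "{p \<in> space (weak_borel \<Otimes>\<^sub>M unit_lebesgue). quantile (fst p) (snd p) \<le> x}
      \<in> sets (weak_borel \<Otimes>\<^sub>M unit_lebesgue)" .
qed

lemma measurable_quantile [measurable (raw)]: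
  assumes "m \<in> measurable N weak_borel" "f \<in> measurable N unit_lebesgue"
  shows "(\<lambda>w. quantile (m w) (f w)) \<in> borel_measurable N"
  using measurable_compose[OF measurable_Pair[OF assms] measurable_quantile_pair] by simp

section \<open>The monotone coupling is optimal\<close>

text \<open>The interval \<open>{b + s..<a}\<close> has length \<open>max 0 (a - b - s)\<close>; integrate its indicator in the other
  order.\<close>

lemma hinge_layer_cake:
  assumes "prob_space \<Gamma>" and [measurable]: "X \<in> borel_measurable \<Gamma>" "Y \<in> borel_measurable \<Gamma>"
  shows "(\<integral>\<^sup>+\<omega>. ennreal (max 0 (X \<omega> - Y \<omega> - s)) \<partial>\<Gamma>)
    = (\<integral>\<^sup>+u. emeasure \<Gamma> {\<omega> \<in> space \<Gamma>. Y \<omega> \<le> u - s \<and> u < X \<omega>} \<partial>lborel)"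
proof -
  interpret prob_space \<Gamma> by fact
  interpret pair_sigma_finite lborel \<Gamma> ..
  have "(\<integral>\<^sup>+\<omega>. ennreal (max 0 (X \<omega> - Y \<omega> - s)) \<partial>\<Gamma>)
      = (\<integral>\<^sup>+\<omega>. (\<integral>\<^sup>+u. indicator {u. Y \<omega> \<le> u - s \<and> u < X \<omega>} u \<partial>lborel) \<partial>\<Gamma>)"
  proof (rule nn_integral_cong)
    fix \<omega>
    have "{u. Y \<omega> \<le> u - s \<and> u < X \<omega>} = {Y \<omega> + s ..< X \<omega>}" by auto
    then show "ennreal (max 0 (X \<omega> - Y \<omega> - s))
        = (\<integral>\<^sup>+u. indicator {u. Y \<omega> \<le> u - s \<and> u < X \<omega>} u \<partial>lborel)"
      by (cases "Y \<omega> + s \<le> X \<omega>") (auto simp: max_def algebra_simps)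
  qed
  also have "\<dots> = (\<integral>\<^sup>+u. (\<integral>\<^sup>+\<omega>. indicator {u. Y \<omega> \<le> u - s \<and> u < X \<omega>} u \<partial>\<Gamma>) \<partial>lborel)"
    by (rule Fubini') measurable
  also have "\<dots> = (\<integral>\<^sup>+u. emeasure \<Gamma> {\<omega> \<in> space \<Gamma>. Y \<omega> \<le> u - s \<and> u < X \<omega>} \<partial>lborel)"
  proof (rule nn_integral_cong)
    fix u
    have "(\<integral>\<^sup>+\<omega>. indicator {u. Y \<omega> \<le> u - s \<and> u < X \<omega>} u \<partial>\<Gamma>)
        = (\<integral>\<^sup>+\<omega>. indicator {\<omega> \<in> space \<Gamma>. Y \<omega> \<le> u - s \<and> u < X \<omega>} \<omega> \<partial>\<Gamma>)"
      by (intro nn_integral_cong) (auto split: split_indicator)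
    also have "\<dots> = emeasure \<Gamma> {\<omega> \<in> space \<Gamma>. Y \<omega> \<le> u - s \<and> u < X \<omega>}"
      by (intro nn_integral_indicator) measurable
    finally show "(\<integral>\<^sup>+\<omega>. indicator {u. Y \<omega> \<le> u - s \<and> u < X \<omega>} u \<partial>\<Gamma>)
        = emeasure \<Gamma> {\<omega> \<in> space \<Gamma>. Y \<omega> \<le> u - s \<and> u < X \<omega>}" .
  qed
  finally show ?thesis .
qed

text \<open>For hinge costs \<open>z \<mapsto> max 0 (z - s)\<close> the comparison holds at every level \<open>u\<close> of the layer cake
  formula: every coupling gives the event \<open>Y \<le> u - s \<and> u < X\<close> at least the probability
  \<open>P(Y \<le> u - s) - P(X \<le> u)\<close>, while under the monotone coupling it is the interval of levels
  between \<open>cdf \<mu> u\<close> and \<open>cdf \<nu> (u - s)\<close>.\<close>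

lemma hinge_cost_quantile_le:
  assumes \<Gamma>: "prob_space \<Gamma>" and [measurable]: "X \<in> borel_measurable \<Gamma>" "Y \<in> borel_measurable \<Gamma>"
  defines "\<mu> \<equiv> distr \<Gamma> borel X" and "\<nu> \<equiv> distr \<Gamma> borel Y"
  shows "(\<integral>\<^sup>+t. ennreal (max 0 (quantile \<mu> t - quantile \<nu> t - s)) \<partial>unit_lebesgue)
    \<le> (\<integral>\<^sup>+\<omega>. ennreal (max 0 (X \<omega> - Y \<omega> - s)) \<partial>\<Gamma>)"
proof -
  interpret prob_space \<Gamma> by fact
  have \<mu>: "\<mu> \<in> borel_probs" and \<nu>: "\<nu> \<in> borel_probs"
    unfolding \<mu>_def \<nu>_def borel_probs_def by (auto intro!: prob_space_distr)
  note [measurable] = measurable_quantile1[OF \<mu>] measurable_quantile1[OF \<nu>]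
  show ?thesis
    unfolding hinge_layer_cake[OF \<Gamma> assms(2,3)]
      hinge_layer_cake[OF prob_space_unit_lebesgue measurable_quantile1[OF \<mu>] measurable_quantile1[OF \<nu>]]
  proof (rule nn_integral_mono)
    fix u
    let ?S = "{t \<in> space unit_lebesgue. quantile \<nu> t \<le> u - s \<and> u < quantile \<mu> t}"
    have "?S \<subseteq> {cdf \<mu> u<..cdf \<nu> (u - s)}"
      using quantile_le_iff[OF \<mu>, of _ u] quantile_le_iff[OF \<nu>, of _ "u - s"] by (force simp: not_le[symmetric])
    then have "emeasure unit_lebesgue ?S \<le> ennreal (cdf \<nu> (u - s) - cdf \<mu> u)"
      by (rule emeasure_unit_lebesgue_le) measurable
    also have "cdf \<mu> u = prob {\<omega> \<in> space \<Gamma>. X \<omega> \<le> u}"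
      unfolding \<mu>_def cdf_def by (subst measure_distr) (auto intro!: arg_cong[where f=prob])
    also have "cdf \<nu> (u - s) = prob {\<omega> \<in> space \<Gamma>. Y \<omega> \<le> u - s}"
      unfolding \<nu>_def cdf_def by (subst measure_distr) (auto intro!: arg_cong[where f=prob])
    also have "ennreal (prob {\<omega> \<in> space \<Gamma>. Y \<omega> \<le> u - s} - prob {\<omega> \<in> space \<Gamma>. X \<omega> \<le> u})
        \<le> ennreal (prob {\<omega> \<in> space \<Gamma>. Y \<omega> \<le> u - s \<and> u < X \<omega>})"
    proof (rule ennreal_leI)
      have "prob {\<omega> \<in> space \<Gamma>. Y \<omega> \<le> u - s}
          \<le> prob ({\<omega> \<in> space \<Gamma>. Y \<omega> \<le> u - s \<and> u < X \<omega>} \<union> {\<omega> \<in> space \<Gamma>. X \<omega> \<le> u})"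
        by (intro finite_measure_mono) auto
      also have "\<dots> \<le> prob {\<omega> \<in> space \<Gamma>. Y \<omega> \<le> u - s \<and> u < X \<omega>} + prob {\<omega> \<in> space \<Gamma>. X \<omega> \<le> u}"
        by (intro measure_Un_le) auto
      finally show "prob {\<omega> \<in> space \<Gamma>. Y \<omega> \<le> u - s} - prob {\<omega> \<in> space \<Gamma>. X \<omega> \<le> u}
        \<le> prob {\<omega> \<in> space \<Gamma>. Y \<omega> \<le> u - s \<and> u < X \<omega>}" by simp
    qed
    finally show "emeasure unit_lebesgue ?S \<le> emeasure \<Gamma> {\<omega> \<in> space \<Gamma>. Y \<omega> \<le> u - s \<and> u < X \<omega>}"
      by (simp add: emeasure_eq_measure)
  qed
qed

text \<open>A combination of hinges with kinks on the grid of mesh \<open>h\<close>. The coefficients are the divided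
  second differences of \<open>f\<close>, nonnegative when \<open>f\<close> is convex. For \<open>f\<close>
  vanishing on the negative half line this is the piecewise linear interpolation of \<open>f\<close>, moved by \<open>h\<close> to the right, and made affine after the
  \<open>N\<close>-th kink. The shift keeps it below \<open>f\<close>.\<close>

definition hinge_sum :: "(real \<Rightarrow> real) \<Rightarrow> real \<Rightarrow> nat \<Rightarrow> real \<Rightarrow> real" where
  "hinge_sum f h N z = (\<Sum>j<N. (f ((real j + 1) * h) - 2 * f (real j * h) + f ((real j - 1) * h)) / h
      * max 0 (z - (real j + 1) * h))"

text \<open>Summation by parts, twice.\<close>

lemma second_difference_sum:
  fixes a :: "nat \<Rightarrow> real"
  assumes "a 0 = 0" "a 1 = 0"
  shows "(\<Sum>j<m. (a (j + 2) - 2 * a (j + 1) + a j) * (real m - real j - 1)) = a m"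
proof (induction m)
  case (Suc m)
  let ?d = "\<lambda>j. a (j + 2) - 2 * a (j + 1) + a j"
  have d: "(\<Sum>j<m. ?d j) = a (m + 1) - a m" for m
    using assms by (induction m) auto
  have "(\<Sum>j<Suc m. ?d j * (real (Suc m) - real j - 1)) = (\<Sum>j<m. ?d j * (real m - real j - 1) + ?d j)"
    by (simp add: algebra_simps)
  also have "\<dots> = (\<Sum>j<m. ?d j * (real m - real j - 1)) + (\<Sum>j<m. ?d j)"
    by (rule sum.distrib)
  also have "\<dots> = a (Suc m)"
    unfolding Suc d by simp
  finally show ?case .
qed (simp add: assms)

context
  fixes f :: "real \<Rightarrow> real"
  assumes convex: "convex_on UNIV f" and zero: "\<And>x. x \<le> 0 \<Longrightarrow> f x = 0" and nonneg: "\<And>x. 0 \<le> f x"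
begin

lemma convex_zero_left_mono: "x \<le> y \<Longrightarrow> f x \<le> f y"
proof (cases "x \<le> 0")
  case False
  assume "x \<le> y"
  define t where "t = x / y"
  have t: "0 \<le> t" "t \<le> 1" "t * y = x" using False \<open>x \<le> y\<close> by (auto simp: t_def)
  have "f ((1 - t) *\<^sub>R 0 + t *\<^sub>R y) \<le> (1 - t) * f 0 + t * f y"
    using t by (intro convex_onD[OF convex]) auto
  also have "\<dots> \<le> f y" using t nonneg[of y] by (simp add: zero mult_left_le_one_le)
  finally show ?thesis using t by simp
qed (simp add: zero nonneg)

lemma hinge_coefficient_nonneg:
  assumes "0 < h"
  shows "0 \<le> (f ((real j + 1) * h) - 2 * f (real j * h) + f ((real j - 1) * h)) / h"
proof -
  have "f ((1 - 1/2) *\<^sub>R ((real j - 1) * h) + (1/2) *\<^sub>R ((real j + 1) * h))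
      \<le> (1 - 1/2) * f ((real j - 1) * h) + (1/2) * f ((real j + 1) * h)"
    by (intro convex_onD[OF convex]) auto
  moreover have "(1 - 1/2) *\<^sub>R ((real j - 1) * h) + (1/2) *\<^sub>R ((real j + 1) * h) = real j * h"
    by (simp add: field_simps)
  ultimately show ?thesis using assms by simp
qed

lemma hinge_sum_grid:
  assumes "0 < h" "m \<le> N"
  shows "hinge_sum f h N (real m * h) = f ((real m - 1) * h)"
proof -
  define a where "a j = f ((real j - 1) * h)" for j :: nat
  have a: "a 0 = 0" "a 1 = 0" using assms by (auto simp: a_def zero)
  have max: "max 0 (real m * h - (real j + 1) * h) = h * max 0 (real m - real j - 1)" for j
    using assms(1) max_mult_distrib_left[of h 0 "real m - real j - 1"] by (simp add: algebra_simps)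
  have "hinge_sum f h N (real m * h)
      = (\<Sum>j<N. (a (j + 2) - 2 * a (j + 1) + a j) * max 0 (real m - real j - 1))"
    unfolding hinge_sum_def max a_def using assms(1) by (intro sum.cong refl) (simp add: add.commute)
  also have "\<dots> = (\<Sum>j<m. (a (j + 2) - 2 * a (j + 1) + a j) * max 0 (real m - real j - 1))"
    using assms(2) by (intro sum.mono_neutral_right) auto
  also have "\<dots> = (\<Sum>j<m. (a (j + 2) - 2 * a (j + 1) + a j) * (real m - real j - 1))"
    by (intro sum.cong refl) (auto simp: max_def)
  also have "\<dots> = a m" by (rule second_difference_sum[OF a])
  finally show ?thesis by (simp add: a_def)
qed

lemma hinge_sum_mono:
  assumes "0 < h" "x \<le> y"
  shows "hinge_sum f h N x \<le> hinge_sum f h N y"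
  unfolding hinge_sum_def
  using assms by (intro sum_mono mult_left_mono hinge_coefficient_nonneg) auto

text \<open>On the grid the sum takes the value of \<open>f\<close> one step to the left, and \<open>z\<close> is compared with the grid
  point above it. Adding hinges only increases the sum, so \<open>N\<close> may be taken as large as needed.\<close>

lemma hinge_sum_le:
  assumes "0 < h"
  shows "hinge_sum f h N z \<le> f z"
proof (cases "z \<le> 0")
  case True
  have "0 < (real j + 1) * h" for j using assms by simp
  then have "max 0 (z - (real j + 1) * h) = 0" for j
    using True by (simp add: max_def) (meson less_le_not_le order_trans)
  then show ?thesis by (simp add: hinge_sum_def nonneg)
next
  case False
  define m where "m = nat \<lceil>z / h\<rceil>"
  have m: "z \<le> real m * h" "(real m - 1) * h \<le> z"
  proof -
    have "z / h \<le> real m" unfolding m_def by linarith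
    then show "z \<le> real m * h" using assms by (simp add: field_simps)
    have "0 < z / h" using False assms by simp
    then have "real m - 1 \<le> z / h" unfolding m_def by linarith
    then show "(real m - 1) * h \<le> z" using assms by (simp add: field_simps)
  qed
  have "hinge_sum f h N z \<le> hinge_sum f h (max N m) z"
    unfolding hinge_sum_def using assms
    by (intro sum_mono2 mult_nonneg_nonneg hinge_coefficient_nonneg) auto
  also have "\<dots> \<le> hinge_sum f h (max N m) (real m * h)" by (rule hinge_sum_mono[OF assms m(1)])
  also have "\<dots> = f ((real m - 1) * h)" by (intro hinge_sum_grid assms) auto
  also have "\<dots> \<le> f z" by (intro convex_zero_left_mono m)
  finally show ?thesis .
qed

lemma hinge_sum_ge:
  assumes "0 < h" "z \<le> real N * h"
  shows "f (z - 2 * h) \<le> hinge_sum f h N z"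
proof (cases "z \<le> 0")
  case True
  have "0 \<le> hinge_sum f h N z"
    unfolding hinge_sum_def
    using assms by (intro sum_nonneg mult_nonneg_nonneg hinge_coefficient_nonneg) auto
  then show ?thesis using True assms by (simp add: zero)
next
  case False
  define m where "m = nat \<lfloor>z / h\<rfloor>"
  have m: "real m * h \<le> z" "z - h \<le> real m * h" "m \<le> N"
  proof -
    have pos: "0 < z / h" using False assms by simp
    then have "real m \<le> z / h" unfolding m_def by linarith
    then show "real m * h \<le> z" using assms by (simp add: field_simps)
    have "z / h - 1 \<le> real m" using pos unfolding m_def by linarith
    then show "z - h \<le> real m * h" using assms by (simp add: field_simps)
    have "z / h \<le> real N" using assms by (simp add: field_simps)
    with \<open>real m \<le> z / h\<close> show "m \<le> N" by linarith
  qed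
  have "f (z - 2 * h) \<le> f ((real m - 1) * h)"
    using m(2) by (intro convex_zero_left_mono) (simp add: algebra_simps)
  also have "\<dots> = hinge_sum f h N (real m * h)" by (intro hinge_sum_grid[symmetric] assms m)
  also have "\<dots> \<le> hinge_sum f h N z" by (intro hinge_sum_mono assms m)
  finally show ?thesis .
qed

text \<open>The mesh \<open>1/(k + 1)\<close> tends to \<open>0\<close>, while the grid of \<open>(k + 1)\<^sup>2\<close> points extends up to \<open>k + 1\<close>.\<close>

lemma hinge_sum_tendsto: "(\<lambda>k. hinge_sum f (1 / Suc k) ((Suc k)\<^sup>2) z) \<longlonglongrightarrow> f z"
proof (rule tendsto_sandwich)
  have "(\<lambda>k. 1 / real (Suc k)) \<longlonglongrightarrow> 0" by real_asymp
  then have "(\<lambda>k. z - 2 * (1 / real (Suc k))) \<longlonglongrightarrow> z - 2 * 0" by (intro tendsto_intros)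
  then have "(\<lambda>k. f (z - 2 * (1 / Suc k))) \<longlonglongrightarrow> f (z - 2 * 0)"
    by (intro continuous_on_tendsto_compose[OF convex_on_continuous[OF open_UNIV convex]]) auto
  then show "(\<lambda>k. f (z - 2 * (1 / Suc k))) \<longlonglongrightarrow> f z" by simp
  obtain K :: nat where K: "z \<le> K" using real_arch_simple by blast
  have "f (z - 2 * (1 / Suc k)) \<le> hinge_sum f (1 / Suc k) ((Suc k)\<^sup>2) z" if "K \<le> k" for k
  proof (rule hinge_sum_ge)
    have "z \<le> real (Suc k)" using K that by linarith
    then show "z \<le> real ((Suc k)\<^sup>2) * (1 / Suc k)"
      by (simp only: power2_eq_square of_nat_mult) simp
  qed simp
  then show "\<forall>\<^sub>F k in sequentially. f (z - 2 * (1 / Suc k)) \<le> hinge_sum f (1 / Suc k) ((Suc k)\<^sup>2) z"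
    by (intro eventually_sequentiallyI[of K]) auto
  show "\<forall>\<^sub>F k in sequentially. hinge_sum f (1 / Suc k) ((Suc k)\<^sup>2) z \<le> f z"
    by (intro always_eventually allI hinge_sum_le) simp
qed auto

text \<open>Fatou's lemma along the hinge sums: these lie below \<open>f\<close>, so the right-hand side serves as a bound
  for all of them, even where the costs are infinite.\<close>

lemma increasing_convex_cost_quantile_le:
  assumes \<Gamma>: "prob_space \<Gamma>" and [measurable]: "X \<in> borel_measurable \<Gamma>" "Y \<in> borel_measurable \<Gamma>"
  defines "\<mu> \<equiv> distr \<Gamma> borel X" and "\<nu> \<equiv> distr \<Gamma> borel Y"
  shows "(\<integral>\<^sup>+t. ennreal (f (quantile \<mu> t - quantile \<nu> t)) \<partial>unit_lebesgue)
    \<le> (\<integral>\<^sup>+\<omega>. ennreal (f (X \<omega> - Y \<omega>)) \<partial>\<Gamma>)" (is "?L \<le> ?R")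
proof -
  interpret prob_space \<Gamma> by fact
  have \<mu>: "\<mu> \<in> borel_probs" and \<nu>: "\<nu> \<in> borel_probs"
    unfolding \<mu>_def \<nu>_def borel_probs_def by (auto intro!: prob_space_distr)
  note [measurable] = measurable_quantile1[OF \<mu>] measurable_quantile1[OF \<nu>]
  define c where "c h j = (f ((real j + 1) * h) - 2 * f (real j * h) + f ((real j - 1) * h)) / h" for h j
  define G where "G k = hinge_sum f (1 / Suc k) ((Suc k)\<^sup>2)" for k
  have G: "ennreal (G k z) = (\<Sum>j<(Suc k)\<^sup>2. ennreal (c (1 / Suc k) j) * ennreal (max 0 (z - (real j + 1) * (1 / Suc k))))" for k z
    unfolding G_def hinge_sum_def c_def[symmetric]
    using hinge_coefficient_nonneg[of "1 / Suc k", folded c_def]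
    by (subst sum_ennreal[symmetric]) (auto intro!: sum.cong simp: ennreal_mult)
  have [measurable]: "G k \<in> borel_measurable borel" for k
    unfolding G_def hinge_sum_def by measurable
  have step: "(\<integral>\<^sup>+t. ennreal (G k (quantile \<mu> t - quantile \<nu> t)) \<partial>unit_lebesgue) \<le> ?R" for k
  proof -
    have "(\<integral>\<^sup>+t. ennreal (G k (quantile \<mu> t - quantile \<nu> t)) \<partial>unit_lebesgue)
        = (\<Sum>j<(Suc k)\<^sup>2. ennreal (c (1 / Suc k) j) *
            (\<integral>\<^sup>+t. ennreal (max 0 (quantile \<mu> t - quantile \<nu> t - (real j + 1) * (1 / Suc k))) \<partial>unit_lebesgue))"
      unfolding G by (simp add: nn_integral_sum nn_integral_cmult)
    also have "\<dots> \<le> (\<Sum>j<(Suc k)\<^sup>2. ennreal (c (1 / Suc k) j) *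
            (\<integral>\<^sup>+\<omega>. ennreal (max 0 (X \<omega> - Y \<omega> - (real j + 1) * (1 / Suc k))) \<partial>\<Gamma>))"
      unfolding \<mu>_def \<nu>_def by (intro sum_mono mult_left_mono hinge_cost_quantile_le assms) auto
    also have "\<dots> = (\<integral>\<^sup>+\<omega>. ennreal (G k (X \<omega> - Y \<omega>)) \<partial>\<Gamma>)"
      unfolding G by (simp add: nn_integral_sum nn_integral_cmult)
    also have "\<dots> \<le> ?R"
      unfolding G_def by (intro nn_integral_mono ennreal_leI hinge_sum_le) simp
    finally show ?thesis .
  qed
  have "?L = (\<integral>\<^sup>+t. liminf (\<lambda>k. ennreal (G k (quantile \<mu> t - quantile \<nu> t))) \<partial>unit_lebesgue)"
    using hinge_sum_tendsto unfolding G_def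
    by (intro nn_integral_cong lim_imp_Liminf[symmetric] tendsto_ennrealI) auto
  also have "\<dots> \<le> liminf (\<lambda>k. \<integral>\<^sup>+t. ennreal (G k (quantile \<mu> t - quantile \<nu> t)) \<partial>unit_lebesgue)"
    by (rule nn_integral_liminf) measurable
  also have "\<dots> \<le> limsup (\<lambda>k. \<integral>\<^sup>+t. ennreal (G k (quantile \<mu> t - quantile \<nu> t)) \<partial>unit_lebesgue)"
    by (rule Liminf_le_Limsup) simp
  also have "\<dots> \<le> ?R"
    using step by (intro Limsup_bounded always_eventually) auto
  finally show ?thesis .
qed

end

lemma convex_positive_part:
  assumes g: "strictly_convex_fun g" and min: "\<And>x. g 0 \<le> g x"
  shows "convex_on UNIV (\<lambda>x. g (max 0 x))"
proof (rule convex_onI)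
  fix t x y :: real assume t: "0 < t" "t < 1"
  let ?a = "max 0 ((1 - t) * x + t * y)" and ?b = "(1 - t) * max 0 x + t * max 0 y"
  have "(1 - t) * x + t * y \<le> ?b" "0 \<le> ?b"
    using t by (auto intro!: add_mono mult_left_mono)
  then have "g ?a \<le> g ?b"
    using strictly_convex_less_right[OF g min, of ?a ?b] by (cases "?a < ?b") (auto simp: not_less intro: antisym)
  also have "\<dots> \<le> (1 - t) * g (max 0 x) + t * g (max 0 y)"
    using convex_onD[OF strictly_convex_fun_convex_on[OF g], of t "max 0 x" "max 0 y"] t by simp
  finally show "g (max 0 ((1 - t) *\<^sub>R x + t *\<^sub>R y)) \<le> (1 - t) * g (max 0 x) + t * g (max 0 y)"
    by simp
qed auto

locale transport_cost_function =
  fixes g :: "real \<Rightarrow> real"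
  assumes strictly_convex: "strictly_convex_fun g" and g_0 [simp]: "g 0 = 0"
    and g_nonneg [simp]: "0 \<le> g x"
begin

lemma measurable_g [measurable]: "g \<in> borel_measurable borel"
  by (rule strictly_convex_fun_measurable[OF strictly_convex])

text \<open>Split \<open>g\<close> into its right branch, an increasing function of \<open>x - y\<close>, and its left branch, an
  increasing function of \<open>y - x\<close>. The monotone coupling is optimal for both.\<close>

lemma cost_quantile_le:
  assumes \<Gamma>: "prob_space \<Gamma>" and [measurable]: "X \<in> borel_measurable \<Gamma>" "Y \<in> borel_measurable \<Gamma>"
  defines "\<mu> \<equiv> distr \<Gamma> borel X" and "\<nu> \<equiv> distr \<Gamma> borel Y"
  shows "(\<integral>\<^sup>+t. ennreal (g (quantile \<mu> t - quantile \<nu> t)) \<partial>unit_lebesgue)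
    \<le> (\<integral>\<^sup>+\<omega>. ennreal (g (X \<omega> - Y \<omega>)) \<partial>\<Gamma>)"
proof -
  interpret prob_space \<Gamma> by fact
  have \<mu>: "\<mu> \<in> borel_probs" and \<nu>: "\<nu> \<in> borel_probs"
    unfolding \<mu>_def \<nu>_def borel_probs_def by (auto intro!: prob_space_distr)
  note [measurable] = measurable_quantile1[OF \<mu>] measurable_quantile1[OF \<nu>]
  define g1 where "g1 z = g (max 0 z)" for z
  define g2 where "g2 z = g (- max 0 z)" for z
  have [measurable]: "g1 \<in> borel_measurable borel" "g2 \<in> borel_measurable borel"
    unfolding g1_def g2_def by measurable
  have split: "ennreal (g (x - y)) = ennreal (g1 (x - y)) + ennreal (g2 (y - x))" for x y
    by (cases "x \<le> y") (auto simp: g1_def g2_def max_def ennreal_plus[symmetric] simp del: ennreal_plus)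
  have 1: "(\<integral>\<^sup>+t. ennreal (g1 (quantile \<mu> t - quantile \<nu> t)) \<partial>unit_lebesgue)
      \<le> (\<integral>\<^sup>+\<omega>. ennreal (g1 (X \<omega> - Y \<omega>)) \<partial>\<Gamma>)"
    unfolding \<mu>_def \<nu>_def
  proof (rule increasing_convex_cost_quantile_le)
    show "convex_on UNIV g1"
      unfolding g1_def by (rule convex_positive_part[OF strictly_convex]) simp
  qed (use \<Gamma> in \<open>auto simp: g1_def max_def\<close>)
  have 2: "(\<integral>\<^sup>+t. ennreal (g2 (quantile \<nu> t - quantile \<mu> t)) \<partial>unit_lebesgue)
      \<le> (\<integral>\<^sup>+\<omega>. ennreal (g2 (Y \<omega> - X \<omega>)) \<partial>\<Gamma>)"
    unfolding \<mu>_def \<nu>_def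
  proof (rule increasing_convex_cost_quantile_le)
    show "convex_on UNIV g2"
      unfolding g2_def
      by (rule convex_positive_part[OF strictly_convex_fun_reflect[OF strictly_convex]]) simp
  qed (use \<Gamma> in \<open>auto simp: g2_def max_def\<close>)
  show ?thesis unfolding split using add_mono[OF 1 2] by (simp add: nn_integral_add)
qed

lemma transport_cost_distr_le:
  assumes "prob_space \<Gamma>" and [measurable]: "X \<in> borel_measurable \<Gamma>" "Y \<in> borel_measurable \<Gamma>"
  shows "transport_cost g (distr \<Gamma> borel X) (distr \<Gamma> borel Y)
    \<le> (\<integral>\<^sup>+\<omega>. ennreal (g (X \<omega> - Y \<omega>)) \<partial>\<Gamma>)"
proof -
  interpret prob_space \<Gamma> by fact
  let ?\<gamma> = "distr \<Gamma> borel (\<lambda>\<omega>. (X \<omega>, Y \<omega>))"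
  have [measurable]: "fst \<in> borel_measurable (borel :: (real \<times> real) measure)"
    "snd \<in> borel_measurable (borel :: (real \<times> real) measure)"
    by (simp_all add: borel_prod[symmetric])
  have "?\<gamma> \<in> couplings (distr \<Gamma> borel X) (distr \<Gamma> borel Y)"
    unfolding couplings_def by (auto intro!: prob_space_distr simp: distr_distr comp_def)
  then have "transport_cost g (distr \<Gamma> borel X) (distr \<Gamma> borel Y)
      \<le> (\<integral>\<^sup>+p. ennreal (g (fst p - snd p)) \<partial>?\<gamma>)"
    unfolding transport_cost_def by (rule INF_lower)
  also have "\<dots> = (\<integral>\<^sup>+\<omega>. ennreal (g (X \<omega> - Y \<omega>)) \<partial>\<Gamma>)"
    by (subst nn_integral_distr) auto
  finally show ?thesis .
qed

theorem transport_cost_eq_quantile: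
  assumes \<mu>: "\<mu> \<in> borel_probs" and \<nu>: "\<nu> \<in> borel_probs"
  shows "transport_cost g \<mu> \<nu> = (\<integral>\<^sup>+t. ennreal (g (quantile \<mu> t - quantile \<nu> t)) \<partial>unit_lebesgue)"
proof (rule antisym)
  show "transport_cost g \<mu> \<nu> \<le> (\<integral>\<^sup>+t. ennreal (g (quantile \<mu> t - quantile \<nu> t)) \<partial>unit_lebesgue)"
    using transport_cost_distr_le[OF prob_space_unit_lebesgue
        measurable_quantile1[OF \<mu>] measurable_quantile1[OF \<nu>]]
    by (simp add: distr_quantile \<mu> \<nu>)
  show "(\<integral>\<^sup>+t. ennreal (g (quantile \<mu> t - quantile \<nu> t)) \<partial>unit_lebesgue) \<le> transport_cost g \<mu> \<nu>"
    unfolding transport_cost_def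
  proof (rule INF_greatest)
    fix \<gamma> assume "\<gamma> \<in> couplings \<mu> \<nu>"
    then have \<gamma>: "prob_space \<gamma>" "sets \<gamma> = sets (borel \<Otimes>\<^sub>M borel)"
        "distr \<gamma> borel fst = \<mu>" "distr \<gamma> borel snd = \<nu>"
      unfolding couplings_def borel_prod by blast+
    have "fst \<in> borel_measurable \<gamma>" "snd \<in> borel_measurable \<gamma>"
      using measurable_fst measurable_snd measurable_cong_sets[OF \<gamma>(2) refl] by blast+
    from cost_quantile_le[OF \<gamma>(1) this] show
      "(\<integral>\<^sup>+t. ennreal (g (quantile \<mu> t - quantile \<nu> t)) \<partial>unit_lebesgue)
        \<le> (\<integral>\<^sup>+p. ennreal (g (fst p - snd p)) \<partial>\<gamma>)"
      unfolding \<gamma>(3,4) .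
  qed
qed

end

section \<open>Integrals: equality, limits and domination\<close>

lemma AE_eq_if_nn_integral_le:
  fixes f h :: "'a \<Rightarrow> ennreal"
  assumes [measurable]: "f \<in> borel_measurable N" "h \<in> borel_measurable N"
    and le: "AE x in N. f x \<le> h x" and int: "(\<integral>\<^sup>+x. h x \<partial>N) \<le> (\<integral>\<^sup>+x. f x \<partial>N)"
    and fin: "(\<integral>\<^sup>+x. f x \<partial>N) < \<infinity>"
  shows "AE x in N. h x = f x"
proof -
  have "(\<integral>\<^sup>+x. h x - f x \<partial>N) = (\<integral>\<^sup>+x. h x \<partial>N) - (\<integral>\<^sup>+x. f x \<partial>N)"
    using fin le by (intro nn_integral_diff) auto
  also have "\<dots> = 0" using int fin by (simp add: diff_eq_0_iff_ennreal)
  finally have "AE x in N. h x - f x = 0" by (subst (asm) nn_integral_0_iff_AE) auto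
  moreover have "AE x in N. f x \<noteq> \<infinity>" using fin by (intro nn_integral_noteq_infinite) auto
  ultimately show ?thesis using le
    by eventually_elim (auto simp: diff_eq_0_iff_ennreal intro: antisym)
qed

lemma pred_LIMSEQ [measurable (raw)]:
  fixes f :: "nat \<Rightarrow> 'a \<Rightarrow> real" and l :: "'a \<Rightarrow> real"
  assumes [measurable]: "\<And>n. f n \<in> borel_measurable N" "l \<in> borel_measurable N"
  shows "Measurable.pred N (\<lambda>x. (\<lambda>n. f n x) \<longlonglongrightarrow> l x)"
proof -
  have "(\<lambda>n. f n x) \<longlonglongrightarrow> l x \<longleftrightarrow> (\<forall>k::nat. \<exists>M. \<forall>n\<ge>M. \<bar>f n x - l x\<bar> < inverse (real (Suc k)))" for x
  proof
    assume "(\<lambda>n. f n x) \<longlonglongrightarrow> l x"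
    then show "\<forall>k::nat. \<exists>M. \<forall>n\<ge>M. \<bar>f n x - l x\<bar> < inverse (real (Suc k))"
      using LIMSEQ_D[of "\<lambda>n. f n x" "l x"] by (auto simp del: of_nat_Suc)
  next
    assume *: "\<forall>k::nat. \<exists>M. \<forall>n\<ge>M. \<bar>f n x - l x\<bar> < inverse (real (Suc k))"
    show "(\<lambda>n. f n x) \<longlonglongrightarrow> l x"
    proof (rule LIMSEQ_I)
      fix r :: real assume "0 < r"
      then obtain k where "inverse (real (Suc k)) < r" using reals_Archimedean by blast
      moreover obtain M where "\<forall>n\<ge>M. \<bar>f n x - l x\<bar> < inverse (real (Suc k))" using * by blast
      ultimately show "\<exists>no. \<forall>n\<ge>no. norm (f n x - l x) < r" by (intro exI[of _ M]) fastforce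
    qed
  qed
  then show ?thesis by simp
qed

text \<open>Dominated convergence with a varying dominating function. By Scheffe's lemma \<open>v n\<close> tends to \<open>w\<close>
  in mean, and \<open>u n \<le> min (u n) w + \<bar>v n - w\<bar>\<close>, where the first term is dominated by \<open>w\<close>.\<close>

lemma nn_integral_tendsto_0_if_dominated:
  fixes u v :: "nat \<Rightarrow> 'a \<Rightarrow> real" and w :: "'a \<Rightarrow> real"
  assumes [measurable]: "\<And>n. u n \<in> borel_measurable N"
    and int_v: "\<And>n. integrable N (v n)" and int_w: "integrable N w"
    and uv: "AE x in N. \<forall>n. 0 \<le> u n x \<and> u n x \<le> v n x"
    and u: "AE x in N. (\<lambda>n. u n x) \<longlonglongrightarrow> 0"
    and v: "AE x in N. (\<lambda>n. v n x) \<longlonglongrightarrow> w x"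
    and int_lim: "(\<lambda>n. \<integral>x. v n x \<partial>N) \<longlonglongrightarrow> (\<integral>x. w x \<partial>N)"
  shows "(\<lambda>n. \<integral>\<^sup>+x. ennreal (u n x) \<partial>N) \<longlonglongrightarrow> 0"
proof -
  have [measurable]: "w \<in> borel_measurable N" "\<And>n. v n \<in> borel_measurable N"
    using int_w int_v by auto
  have v_nonneg: "AE x in N. 0 \<le> v n x" for n using uv by eventually_elim (meson order_trans)
  have w_nonneg: "AE x in N. 0 \<le> w x"
    using uv v
  proof eventually_elim
    case (elim x)
    then have "0 \<le> v n x" for n by (meson order_trans)
    with elim(2) show ?case by (intro LIMSEQ_le_const) auto
  qed
  have 1: "(\<lambda>n. \<integral>\<^sup>+x. norm (v n x - w x) \<partial>N) \<longlonglongrightarrow> 0"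
  proof (rule Scheffe_lemma1[OF int_v int_w v])
    have "(\<integral>\<^sup>+x. norm (v n x) \<partial>N) = ennreal (\<integral>x. v n x \<partial>N)" for n
      using v_nonneg[of n] by (subst nn_integral_eq_integral[symmetric, OF int_v])
        (auto intro!: nn_integral_cong_AE)
    moreover have "(\<integral>\<^sup>+x. norm (w x) \<partial>N) = ennreal (\<integral>x. w x \<partial>N)"
      using w_nonneg by (subst nn_integral_eq_integral[symmetric, OF int_w])
        (auto intro!: nn_integral_cong_AE)
    ultimately show "limsup (\<lambda>n. \<integral>\<^sup>+x. norm (v n x) \<partial>N) \<le> (\<integral>\<^sup>+x. norm (w x) \<partial>N)"
      using lim_imp_Limsup[OF sequentially_bot tendsto_ennrealI[OF int_lim]] by simp
  qed
  have 2: "(\<lambda>n. \<integral>\<^sup>+x. ennreal (min (u n x) (w x)) \<partial>N) \<longlonglongrightarrow> (\<integral>\<^sup>+x. 0 \<partial>N)"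
  proof (rule nn_integral_dominated_convergence[where w="\<lambda>x. ennreal (w x)"])
    show "(\<integral>\<^sup>+x. ennreal (w x) \<partial>N) < \<infinity>"
      using nn_integral_eq_integral[OF int_w w_nonneg] by simp
    show "AE x in N. (\<lambda>n. ennreal (min (u n x) (w x))) \<longlonglongrightarrow> 0"
      using u w_nonneg
    proof eventually_elim
      case (elim x)
      then have "(\<lambda>n. min (u n x) (w x)) \<longlonglongrightarrow> min 0 (w x)" by (intro tendsto_min tendsto_const)
      with elim show ?case using tendsto_ennrealI by fastforce
    qed
  qed (auto intro!: ennreal_leI)
  show ?thesis
  proof (rule tendsto_sandwich[of "\<lambda>_. 0"])
    show "\<forall>\<^sub>F n in sequentially. (\<integral>\<^sup>+x. ennreal (u n x) \<partial>N)
        \<le> (\<integral>\<^sup>+x. ennreal (min (u n x) (w x)) \<partial>N) + (\<integral>\<^sup>+x. norm (v n x - w x) \<partial>N)"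
    proof (intro always_eventually allI)
      fix n
      have "(\<integral>\<^sup>+x. ennreal (u n x) \<partial>N)
          \<le> (\<integral>\<^sup>+x. ennreal (min (u n x) (w x)) + ennreal (norm (v n x - w x)) \<partial>N)"
      proof (rule nn_integral_mono_AE)
        show "AE x in N. ennreal (u n x) \<le> ennreal (min (u n x) (w x)) + ennreal (norm (v n x - w x))"
          using uv w_nonneg
        proof eventually_elim
          case (elim x)
          then have "0 \<le> u n x" "u n x \<le> v n x" by auto
          then have "ennreal (u n x) \<le> ennreal (min (u n x) (w x) + norm (v n x - w x))"
            by (intro ennreal_leI) auto
          then show ?case using \<open>0 \<le> u n x\<close> elim(2) by (subst (asm) ennreal_plus) auto
        qed
      qed
      then show "(\<integral>\<^sup>+x. ennreal (u n x) \<partial>N)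
        \<le> (\<integral>\<^sup>+x. ennreal (min (u n x) (w x)) \<partial>N) + (\<integral>\<^sup>+x. norm (v n x - w x) \<partial>N)"
        by (subst (asm) nn_integral_add) auto
    qed
    show "(\<lambda>n. (\<integral>\<^sup>+x. ennreal (min (u n x) (w x)) \<partial>N) + (\<integral>\<^sup>+x. norm (v n x - w x) \<partial>N)) \<longlonglongrightarrow> 0"
      using tendsto_add[OF 2 1] by simp
  qed auto
qed

section \<open>Barycenters are computed quantile by quantile\<close>

locale quasi_metric_cost = transport_cost_function +
  fixes A B :: real
  assumes A_nonneg: "0 \<le> A" and B_nonneg: "0 \<le> B"
    and growth: "g (x - y) \<le> A + B * (g x + g y)"
begin

lemma g_pos: "x \<noteq> 0 \<Longrightarrow> 0 < g x"
  using strictly_convex_less_right[OF strictly_convex, of 0 0 x]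
    strictly_convex_less_left[OF strictly_convex, of 0 x 0] by (cases x "0 :: real" rule: linorder_cases) auto

text \<open>By convexity \<open>g\<close> grows at least linearly, with slopes \<open>g 1\<close> and \<open>g (-1)\<close> at distance more than
  \<open>1\<close> from the origin.\<close>

lemma g_sublevel_bounded: "\<exists>K. \<forall>x. g x \<le> C \<longrightarrow> \<bar>x\<bar> \<le> K"
proof (intro exI allI impI)
  fix x assume x: "g x \<le> C"
  have lin: "g s * \<bar>x\<bar> \<le> C" if "1 < \<bar>x\<bar>" "s = sgn x" for s
  proof -
    have "g ((1 - 1 / \<bar>x\<bar>) *\<^sub>R 0 + (1 / \<bar>x\<bar>) *\<^sub>R x) \<le> (1 - 1 / \<bar>x\<bar>) * g 0 + 1 / \<bar>x\<bar> * g x"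
      using that by (intro convex_onD[OF strictly_convex_fun_convex_on[OF strictly_convex]]) auto
    moreover have "(1 / \<bar>x\<bar>) *\<^sub>R x = s" using that by (auto simp: sgn_if)
    ultimately have "g s \<le> g x / \<bar>x\<bar>" by simp
    then have "g s * \<bar>x\<bar> \<le> g x" using that by (simp add: field_simps)
    with x show ?thesis by simp
  qed
  have "0 < g 1" "0 < g (-1)" using g_pos by auto
  have C: "0 \<le> C" using x g_nonneg[of x] by linarith
  show "\<bar>x\<bar> \<le> 1 + C / g 1 + C / g (-1)"
  proof (cases "1 < \<bar>x\<bar>")
    case True
    have "\<bar>x\<bar> \<le> C / g 1 \<or> \<bar>x\<bar> \<le> C / g (-1)"
      using lin[OF True refl] True \<open>0 < g 1\<close> \<open>0 < g (-1)\<close>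
      by (cases "0 < x") (auto simp: field_simps sgn_if split: if_splits)
    moreover have "0 \<le> C / g 1" "0 \<le> C / g (-1)" using C by auto
    ultimately show ?thesis by linarith
  next
    case False
    then show ?thesis using C by (smt (verit) divide_nonneg_nonneg g_nonneg)
  qed
qed

context
  fixes R :: "'r measure" and q :: "'r \<Rightarrow> real" and a :: real
  assumes R: "prob_space R" and q [measurable]: "q \<in> borel_measurable R"
    and int0: "integrable R (\<lambda>\<omega>. g (q \<omega> - a))"
begin

interpretation prob_space R by (rule R)

lemma integrable_shifted_cost: "integrable R (\<lambda>\<omega>. g (q \<omega> - x))"
proof (rule Bochner_Integration.integrable_bound)
  show "integrable R (\<lambda>\<omega>. A + B * (g (q \<omega> - a) + g (x - a)))" using int0 by simp
  show "AE \<omega> in R. norm (g (q \<omega> - x)) \<le> norm (A + B * (g (q \<omega> - a) + g (x - a)))"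
    using growth[of "q _ - a" "x - a"] A_nonneg B_nonneg by (auto intro!: AE_I2)
qed measurable

lemma strictly_convex_mean_cost: "strictly_convex_fun (\<lambda>x. \<integral>\<omega>. g (q \<omega> - x) \<partial>R)"
  unfolding strictly_convex_fun_def
proof (intro allI impI)
  fix x y t :: real assume "x \<noteq> y" "0 < t" "t < 1"
  have "(\<integral>\<omega>. g (q \<omega> - ((1 - t) * x + t * y)) \<partial>R)
      < (\<integral>\<omega>. (1 - t) * g (q \<omega> - x) + t * g (q \<omega> - y) \<partial>R)"
  proof (rule integral_less_AE_space)
    have "g (q \<omega> - ((1 - t) * x + t * y)) < (1 - t) * g (q \<omega> - x) + t * g (q \<omega> - y)" for \<omega>
      using strictly_convex_funD[OF strictly_convex, of "q \<omega> - x" "q \<omega> - y" t]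
        \<open>x \<noteq> y\<close> \<open>0 < t\<close> \<open>t < 1\<close> by (simp add: algebra_simps)
    then show "AE \<omega> in R. g (q \<omega> - ((1 - t) * x + t * y)) < (1 - t) * g (q \<omega> - x) + t * g (q \<omega> - y)"
      by simp
  qed (auto simp: emeasure_space_1 intro!: integrable_shifted_cost Bochner_Integration.integrable_add integrable_mult_right)
  also have "\<dots> = (1 - t) * (\<integral>\<omega>. g (q \<omega> - x) \<partial>R) + t * (\<integral>\<omega>. g (q \<omega> - y) \<partial>R)"
    by (simp add: integrable_shifted_cost)
  finally show "(\<integral>\<omega>. g (q \<omega> - ((1 - t) * x + t * y)) \<partial>R)
    < (1 - t) * (\<integral>\<omega>. g (q \<omega> - x) \<partial>R) + t * (\<integral>\<omega>. g (q \<omega> - y) \<partial>R)" .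
qed

text \<open>The growth condition, applied to \<open>x = q - (q - x)\<close>, bounds \<open>g x\<close> by
  \<open>A + B (\<phi> 0 + \<phi> x)\<close> with \<open>\<phi>\<close> the mean cost. Sublevel sets of \<open>\<phi>\<close> are therefore bounded.\<close>

lemma mean_cost_minimizer_exists: "\<exists>b. \<forall>x. (\<integral>\<omega>. g (q \<omega> - b) \<partial>R) \<le> (\<integral>\<omega>. g (q \<omega> - x) \<partial>R)"
proof -
  let ?\<phi> = "\<lambda>x. \<integral>\<omega>. g (q \<omega> - x) \<partial>R"
  obtain K where K: "\<And>z. g z \<le> A + 2 * B * ?\<phi> 0 \<Longrightarrow> \<bar>z\<bar> \<le> K"
    using g_sublevel_bounded by blast
  show ?thesis
  proof (rule strictly_convex_minimizer_exists[OF strictly_convex_mean_cost])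
    fix x assume le: "?\<phi> x \<le> ?\<phi> 0"
    have "g x \<le> A + B * (?\<phi> 0 + ?\<phi> x)"
    proof -
      have "g x = (\<integral>\<omega>. g x \<partial>R)" by (simp add: prob_space)
      also have "\<dots> \<le> (\<integral>\<omega>. A + B * (g (q \<omega> - 0) + g (q \<omega> - x)) \<partial>R)"
      proof (rule integral_mono)
        show "integrable R (\<lambda>\<omega>. A + B * (g (q \<omega> - 0) + g (q \<omega> - x)))"
          by (intro Bochner_Integration.integrable_add integrable_mult_right integrable_shifted_cost) simp
        show "g x \<le> A + B * (g (q \<omega> - 0) + g (q \<omega> - x))" for \<omega>
          using growth[of "q \<omega> - 0" "q \<omega> - x"] by simp
      qed simp
      also have "\<dots> = A + B * (?\<phi> 0 + ?\<phi> x)"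
        using integrable_shifted_cost[of 0] by (simp add: integrable_shifted_cost prob_space)
      finally show ?thesis .
    qed
    also have "\<dots> \<le> A + B * (?\<phi> 0 + ?\<phi> 0)" using le B_nonneg by (intro add_left_mono mult_left_mono) auto
    finally show "\<bar>x\<bar> \<le> K" by (intro K) (simp add: algebra_simps)
  qed
qed

end

text \<open>By Tonelli \<open>\<Phi> \<nu> = \<integral> e t (quantile \<nu> t) dt\<close> with \<open>e t x = \<integral> g(quantile (m \<omega>) t - x) dR\<close>. Let
  \<open>b t\<close> minimize \<open>e t\<close>, and let \<open>\<nu>b\<close> be the law of \<open>b\<close> under Lebesgue measure on the unit interval.
  Pairing the quantiles of \<open>m \<omega>\<close> with \<open>b\<close> gives a coupling of \<open>m \<omega>\<close> and \<open>\<nu>b\<close>, so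
  \<open>\<Phi> \<nu>b \<le> \<integral> e t (b t) dt \<le> \<Phi> \<nu>\<close> for all \<open>\<nu>\<close>. If \<open>\<nu>\<close> is another minimizer, then both inequalities are equalities and
  strict convexity yields \<open>quantile \<nu> t = b t\<close> for almost every \<open>t\<close>; this shows uniqueness, and
  for \<open>\<nu> = \<nu>b\<close> it identifies the quantile function of the barycenter.\<close>

theorem barycenter_quantiles:
  fixes R :: "'r measure" and m :: "'r \<Rightarrow> real measure"
  assumes R: "prob_space R" and m [measurable]: "m \<in> measurable R weak_borel"
  defines "\<Phi> \<equiv> \<lambda>\<nu>. \<integral>\<^sup>+\<omega>. transport_cost g (m \<omega>) \<nu> \<partial>R"
  assumes finite_value: "has_finite_value \<Phi>"
  shows "minimizer \<Phi> \<in> borel_probs" "\<Phi> (minimizer \<Phi>) < \<infinity>"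
    "AE t in unit_lebesgue. \<forall>x. integrable R (\<lambda>\<omega>. g (quantile (m \<omega>) t - x)) \<and>
      (\<integral>\<omega>. g (quantile (m \<omega>) t - quantile (minimizer \<Phi>) t) \<partial>R)
        \<le> (\<integral>\<omega>. g (quantile (m \<omega>) t - x) \<partial>R)"
proof -
  interpret R: prob_space R by (rule R)
  interpret U: prob_space unit_lebesgue by (rule prob_space_unit_lebesgue)
  interpret pair_sigma_finite unit_lebesgue R ..
  have mp: "m \<omega> \<in> borel_probs" if "\<omega> \<in> space R" for \<omega>
    using measurable_space[OF m that] by simp
  define e where "e t x = (\<integral>\<^sup>+\<omega>. ennreal (g (quantile (m \<omega>) t - x)) \<partial>R)" for t x
  have meas_e [measurable]: "(\<lambda>t. e t (f t)) \<in> borel_measurable unit_lebesgue"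
    if [measurable]: "f \<in> borel_measurable unit_lebesgue" for f
    unfolding e_def by measurable
  have swap: "(\<integral>\<^sup>+\<omega>. \<integral>\<^sup>+t. ennreal (g (quantile (m \<omega>) t - f t)) \<partial>unit_lebesgue \<partial>R)
      = (\<integral>\<^sup>+t. e t (f t) \<partial>unit_lebesgue)"
    if [measurable]: "f \<in> borel_measurable unit_lebesgue" for f
    unfolding e_def by (rule Fubini') measurable
  have \<Phi>: "\<Phi> \<nu> = (\<integral>\<^sup>+t. e t (quantile \<nu> t) \<partial>unit_lebesgue)" if "\<nu> \<in> borel_probs" for \<nu>
    unfolding swap[OF measurable_quantile1[OF that], symmetric] \<Phi>_def
    by (intro nn_integral_cong transport_cost_eq_quantile mp that)
  have meas_q [measurable]: "(\<lambda>\<omega>. quantile (m \<omega>) t) \<in> borel_measurable R" if "0 < t" "t < 1" for t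
    using that by (intro measurable_quantile) auto
  have int: "integrable R (\<lambda>\<omega>. g (quantile (m \<omega>) t - x))" if "0 < t" "t < 1" "e t y < \<infinity>" for t x y
  proof (rule integrable_shifted_cost[OF R meas_q[OF that(1,2)]])
    show "integrable R (\<lambda>\<omega>. g (quantile (m \<omega>) t - y))"
      using that(3) meas_q[OF that(1,2)] unfolding e_def by (intro integrableI_nonneg) auto
  qed
  have e_eq: "e t x = ennreal (\<integral>\<omega>. g (quantile (m \<omega>) t - x) \<partial>R)"
    if "0 < t" "t < 1" "e t y < \<infinity>" for t x y
    unfolding e_def using int[OF that] by (intro nn_integral_eq_integral) auto
  \<comment> \<open>At the levels where the mean cost is infinite, \<open>g\<close> stands in as some strictly convex function.\<close>
  define F where "F t x = (if e t 0 < \<infinity> then enn2real (e t x) else g x)" for t x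
  have F_eq: "F t = (\<lambda>x. \<integral>\<omega>. g (quantile (m \<omega>) t - x) \<partial>R)" if "0 < t" "t < 1" "e t 0 < \<infinity>" for t
    using that(3) unfolding F_def by (intro ext) (simp add: e_eq[OF that] integral_nonneg)
  have F_convex: "strictly_convex_fun (F t)" if "0 < t" "t < 1" for t
  proof (cases "e t 0 < \<infinity>")
    case True
    show ?thesis
      unfolding F_eq[OF that True] by (rule strictly_convex_mean_cost[OF R meas_q int]) (use that True in auto)
  next
    case False
    then have "F t = g" by (auto simp: F_def)
    then show ?thesis by (simp add: strictly_convex)
  qed
  have F_min: "\<exists>b. \<forall>x. F t b \<le> F t x" if "0 < t" "t < 1" for t
  proof (cases "e t 0 < \<infinity>")
    case True
    show ?thesis
      unfolding F_eq[OF that True] by (rule mean_cost_minimizer_exists[OF R meas_q int]) (use that True in auto)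
  next
    case False
    then show ?thesis by (intro exI[of _ 0]) (auto simp: F_def)
  qed
  define b where "b t = (SOME b. \<forall>x. F t b \<le> F t x)" for t
  have b: "F t (b t) \<le> F t x" if "0 < t" "t < 1" for t x
    using someI_ex[OF F_min[OF that]] unfolding b_def by blast
  have meas_b [measurable]: "b \<in> borel_measurable unit_lebesgue"
  proof (rule borel_measurable_minimizer[where F=F])
    show "(\<lambda>t. F t x) \<in> borel_measurable unit_lebesgue" for x
      unfolding F_def by measurable
  qed (use F_convex b in auto)
  have e_b: "e t (b t) \<le> e t x" if t: "0 < t" "t < 1" for t x
  proof (cases "e t x < \<infinity>")
    case True
    have fin: "e t 0 < \<infinity>" unfolding e_eq[OF t True] by simp
    show ?thesis
      using b[OF t, of x] unfolding F_eq[OF t fin] e_eq[OF t fin] by (rule ennreal_leI)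
  qed (simp add: not_less top_unique)
  define \<nu>b where "\<nu>b = distr unit_lebesgue borel b"
  have \<nu>b: "\<nu>b \<in> borel_probs"
    unfolding \<nu>b_def borel_probs_def by (auto intro!: U.prob_space_distr)
  have "\<Phi> \<nu>b \<le> (\<integral>\<^sup>+\<omega>. \<integral>\<^sup>+t. ennreal (g (quantile (m \<omega>) t - b t)) \<partial>unit_lebesgue \<partial>R)"
    unfolding \<Phi>_def
  proof (rule nn_integral_mono)
    fix \<omega> assume "\<omega> \<in> space R"
    from transport_cost_distr_le[OF prob_space_unit_lebesgue measurable_quantile1[OF mp[OF this]] meas_b]
    show "transport_cost g (m \<omega>) \<nu>b \<le> (\<integral>\<^sup>+t. ennreal (g (quantile (m \<omega>) t - b t)) \<partial>unit_lebesgue)"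
      by (simp add: \<nu>b_def distr_quantile mp \<open>\<omega> \<in> space R\<close>)
  qed
  then have \<Phi>b: "\<Phi> \<nu>b \<le> (\<integral>\<^sup>+t. e t (b t) \<partial>unit_lebesgue)" by (simp add: swap)
  have b\<Phi>: "(\<integral>\<^sup>+t. e t (b t) \<partial>unit_lebesgue) \<le> \<Phi> \<nu>" if "\<nu> \<in> borel_probs" for \<nu>
    unfolding \<Phi>[OF that] by (intro nn_integral_mono e_b) auto
  have min: "\<Phi> \<nu>b \<le> \<Phi> \<nu>" if "\<nu> \<in> borel_probs" for \<nu>
    using \<Phi>b b\<Phi>[OF that] by (rule order_trans)
  obtain \<nu>0 where "\<nu>0 \<in> borel_probs" "\<Phi> \<nu>0 < \<infinity>"
    using finite_value unfolding has_finite_value_def by blast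
  with min have fin: "\<Phi> \<nu>b < \<infinity>" by (meson le_less_trans)
  then have fin': "(\<integral>\<^sup>+t. e t (b t) \<partial>unit_lebesgue) < \<infinity>" using b\<Phi>[OF \<nu>b] by (rule le_less_trans[rotated])
  have AE_fin: "AE t in unit_lebesgue. e t 0 < \<infinity>"
  proof -
    have "AE t in unit_lebesgue. e t (b t) \<noteq> \<infinity>"
      using fin' by (intro nn_integral_noteq_infinite) auto
    then show ?thesis
      using AE_space by eventually_elim (use e_eq in \<open>force simp: less_top\<close>)
  qed
  have uniq: "AE t in unit_lebesgue. quantile \<nu> t = b t" if \<nu>: "\<nu> \<in> borel_probs" and le: "\<Phi> \<nu> \<le> \<Phi> \<nu>b" for \<nu>
  proof -
    note [measurable] = measurable_quantile1[OF \<nu>]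
    have "AE t in unit_lebesgue. e t (quantile \<nu> t) = e t (b t)"
    proof (rule AE_eq_if_nn_integral_le)
      show "(\<integral>\<^sup>+t. e t (quantile \<nu> t) \<partial>unit_lebesgue) \<le> (\<integral>\<^sup>+t. e t (b t) \<partial>unit_lebesgue)"
        using \<Phi>[OF \<nu>] le \<Phi>b by simp
    qed (use fin' e_b in auto)
    then show ?thesis
      using AE_fin AE_space
    proof eventually_elim
      case (elim t)
      then show ?case
        using strictly_convex_minimizer_unique[OF F_convex b, of t "quantile \<nu> t"] by (simp add: F_def)
    qed
  qed
  have "minimizer \<Phi> = \<nu>b"
    unfolding minimizer_def
  proof (rule the_equality)
    fix \<nu> assume \<nu>: "\<nu> \<in> borel_probs \<and> \<Phi> \<nu> < \<infinity> \<and> (\<forall>\<nu>'\<in>borel_probs. \<Phi> \<nu> \<le> \<Phi> \<nu>')"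
    have "distr unit_lebesgue borel (quantile \<nu>) = distr unit_lebesgue borel b"
      using \<nu> \<nu>b by (intro distr_cong_AE uniq measurable_quantile1 meas_b) auto
    then show "\<nu> = \<nu>b" using \<nu> by (simp add: distr_quantile \<nu>b_def)
  qed (use \<nu>b fin min in auto)
  then show "minimizer \<Phi> \<in> borel_probs" "\<Phi> (minimizer \<Phi>) < \<infinity>"
    using \<nu>b fin by simp_all
  show "AE t in unit_lebesgue. \<forall>x. integrable R (\<lambda>\<omega>. g (quantile (m \<omega>) t - x)) \<and>
      (\<integral>\<omega>. g (quantile (m \<omega>) t - quantile (minimizer \<Phi>) t) \<partial>R)
        \<le> (\<integral>\<omega>. g (quantile (m \<omega>) t - x) \<partial>R)"
    using AE_fin uniq[OF \<nu>b order_refl] AE_space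
  proof eventually_elim
    case (elim t)
    then have t: "0 < t" "t < 1" by auto
    show ?case
      using b[OF t] int[OF t] elim unfolding F_eq[OF t elim(1)] \<open>minimizer \<Phi> = \<nu>b\<close> by simp
  qed
qed

end

section \<open>Consistency of empirical barycenters\<close>

context quasi_metric_cost
begin

lemma measurable_transport_cost [measurable]:
  assumes \<nu>: "\<nu> \<in> borel_probs"
  shows "(\<lambda>\<mu>. transport_cost g \<mu> \<nu>) \<in> borel_measurable weak_borel"
proof -
  interpret U: prob_space unit_lebesgue by (rule prob_space_unit_lebesgue)
  note [measurable] = measurable_quantile1[OF \<nu>]
  have "(\<lambda>\<mu>. \<integral>\<^sup>+t. ennreal (g (quantile \<mu> t - quantile \<nu> t)) \<partial>unit_lebesgue) \<in> borel_measurable weak_borel"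
    by measurable
  then show ?thesis
    by (rule measurable_cong[THEN iffD1, rotated]) (simp add: transport_cost_eq_quantile \<nu>)
qed

text \<open>The empirical case is the population case for the uniform distribution on the indices.\<close>

lemma finite_barycenter_quantiles:
  fixes \<mu> :: "nat \<Rightarrow> real measure"
  assumes n: "0 < n" and \<mu>: "\<And>i. i < n \<Longrightarrow> \<mu> i \<in> borel_probs"
  defines "\<Phi> \<equiv> \<lambda>\<nu>. \<Sum>i<n. ennreal (1 / real n) * transport_cost g (\<mu> i) \<nu>"
  assumes "has_finite_value \<Phi>"
  shows "minimizer \<Phi> \<in> borel_probs"
    "AE t in unit_lebesgue. \<forall>x. (\<Sum>i<n. g (quantile (\<mu> i) t - quantile (minimizer \<Phi>) t)) / n
      \<le> (\<Sum>i<n. g (quantile (\<mu> i) t - x)) / n"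
proof -
  let ?R = "uniform_count_measure {..<n}"
  have R: "prob_space ?R" using n by (intro prob_space_uniform_count_measure) auto
  have m: "\<mu> \<in> measurable ?R weak_borel"
    using \<mu> by (auto simp: measurable_def space_uniform_count_measure sets_uniform_count_measure)
  have \<Phi>: "\<Phi> = (\<lambda>\<nu>. \<integral>\<^sup>+i. transport_cost g (\<mu> i) \<nu> \<partial>?R)"
    by (simp add: \<Phi>_def uniform_count_measure_def nn_integral_point_measure_finite)
  note * = barycenter_quantiles[OF R m, folded \<Phi>, OF \<open>has_finite_value \<Phi>\<close>]
  show "minimizer \<Phi> \<in> borel_probs" by (rule *)
  show "AE t in unit_lebesgue. \<forall>x. (\<Sum>i<n. g (quantile (\<mu> i) t - quantile (minimizer \<Phi>) t)) / n
      \<le> (\<Sum>i<n. g (quantile (\<mu> i) t - x)) / n"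
    using *(3) by (auto simp: integral_uniform_count_measure elim!: eventually_mono)
qed

lemma strictly_convex_average_cost:
  assumes "0 < n"
  shows "strictly_convex_fun (\<lambda>x. (\<Sum>i<n. g (q i - x)) / real n)"
proof -
  have "strictly_convex_fun (\<lambda>x. \<integral>i. g (q i - x) \<partial>uniform_count_measure {..<n})"
    using assms by (intro strictly_convex_mean_cost[where a=0] prob_space_uniform_count_measure)
      (auto simp: uniform_count_measure_def intro!: integrable_point_measure_finite)
  then show ?thesis by (simp add: integral_uniform_count_measure)
qed

text \<open>Apply the growth condition to \<open>c - b = (q i - b) - (q i - c)\<close>, average over \<open>i\<close>, and use that \<open>c\<close>
  has an average cost no larger than \<open>b\<close>.\<close>

lemma distance_to_average_minimizer_le:
  assumes n: "0 < n" and le: "(\<Sum>i<n. g (q i - c)) / real n \<le> (\<Sum>i<n. g (q i - b)) / real n"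
  shows "g (c - b) \<le> A + 2 * B * ((\<Sum>i<n. g (q i - b)) / n)"
    and "g (b - c) \<le> A + 2 * B * ((\<Sum>i<n. g (q i - b)) / n)"
proof -
  let ?S = "\<lambda>x. \<Sum>i<n. g (q i - x)"
  have avg: "y \<le> A + 2 * B * (?S b / n)" if "\<And>i. y \<le> A + B * (g (q i - b) + g (q i - c))" for y
  proof -
    have "real n * y = (\<Sum>i<n. y)" by simp
    also have "\<dots> \<le> (\<Sum>i<n. A + B * (g (q i - b) + g (q i - c)))" by (intro sum_mono that)
    also have "\<dots> = real n * A + B * (?S b + ?S c)"
      by (simp add: sum.distrib sum_distrib_left[symmetric])
    also have "\<dots> \<le> real n * A + B * (?S b + ?S b)"
      using le n B_nonneg by (intro add_left_mono mult_left_mono) (auto simp: divide_le_cancel)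
    also have "\<dots> = real n * (A + 2 * B * (?S b / n))" using n by (simp add: field_simps)
    finally show ?thesis using n by (simp only: mult_le_cancel_left_pos of_nat_0_less_iff)
  qed
  show "g (c - b) \<le> A + 2 * B * (?S b / n)"
  proof (rule avg)
    show "g (c - b) \<le> A + B * (g (q i - b) + g (q i - c))" for i
      using growth[of "q i - b" "q i - c"] by simp
  qed
  show "g (b - c) \<le> A + 2 * B * (?S b / n)"
  proof (rule avg)
    show "g (b - c) \<le> A + B * (g (q i - b) + g (q i - c))" for i
      using growth[of "q i - c" "q i - b"] by (simp add: add.commute)
  qed
qed

text \<open>The barycenters are indexed by \<open>Suc n\<close> because an empty sample has no unique barycenter. The set of
  pairs \<open>(t, \<omega>)\<close> at which the strong law holds is described in terms of the
  sample alone, which makes it measurable and lets Fubini apply; the convergence of the empirical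
  barycenters is then deduced for each fixed \<open>\<omega>\<close>.\<close>

theorem empirical_barycenters_converge:
  fixes Z :: "nat \<Rightarrow> 'w \<Rightarrow> real measure"
  assumes P: "prob_space P" and sets_P: "sets P = sets weak_borel" and M: "prob_space M"
    and indep: "prob_space.indep_vars M (\<lambda>_. weak_borel) Z UNIV"
    and Z: "\<And>i. distr M weak_borel (Z i) = P"
    and ex: "bar_exists g P"
  defines "\<nu> \<equiv> \<lambda>n \<omega>. minimizer (\<lambda>\<nu>. \<Sum>i<n. ennreal (1 / real n) * transport_cost g (Z i \<omega>) \<nu>)"
  shows "AE \<omega> in M. (\<lambda>n. transport_cost g (\<nu> (Suc n) \<omega>) (bar g P)) \<longlonglongrightarrow> 0 \<and>
    (\<lambda>n. transport_cost g (bar g P) (\<nu> (Suc n) \<omega>)) \<longlonglongrightarrow> 0"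
proof -
  interpret P: prob_space P by (rule P)
  interpret M: prob_space M by (rule M)
  interpret U: prob_space unit_lebesgue by (rule prob_space_unit_lebesgue)
  interpret UM: pair_sigma_finite unit_lebesgue M ..
  interpret UP: pair_sigma_finite unit_lebesgue P ..
  have unit_mass: "U.prob {0<..<1} = 1" using U.prob_space by simp
  have [measurable_cong]: "sets P = sets weak_borel" by (rule sets_P)
  have space_P: "space P = borel_probs" using sets_eq_imp_space_eq[OF sets_P] by simp
  have Z_meas [measurable]: "Z i \<in> measurable M weak_borel" for i
    using indep by (auto simp: M.indep_vars_def)
  define \<nu>' where "\<nu>' = bar g P"
  have id: "(\<lambda>\<mu>. \<mu>) \<in> measurable P weak_borel" by measurable
  have \<nu>'_eq: "\<nu>' = minimizer (\<lambda>\<nu>. \<integral>\<^sup>+\<mu>. transport_cost g \<mu> \<nu> \<partial>P)"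
    unfolding \<nu>'_def bar_def frechet_functional_def[abs_def] ..
  note population = barycenter_quantiles[OF P id ex[unfolded bar_exists_def frechet_functional_def[abs_def]],
      folded \<nu>'_eq]
  have \<nu>': "\<nu>' \<in> borel_probs" by (rule population)
  define b where "b = quantile \<nu>'"
  have [measurable]: "b \<in> borel_measurable unit_lebesgue"
    unfolding b_def by (rule measurable_quantile1[OF \<nu>'])
  define J where "J \<mu> = enn2real (transport_cost g \<mu> \<nu>')" for \<mu>
  have J_meas [measurable]: "J \<in> borel_measurable weak_borel"
    unfolding J_def[abs_def] using measurable_transport_cost[OF \<nu>'] by measurable
  have J_fin: "AE \<mu> in P. transport_cost g \<mu> \<nu>' < \<infinity>"
    using nn_integral_noteq_infinite[of "\<lambda>\<mu>. transport_cost g \<mu> \<nu>'" P] population(2)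
      measurable_transport_cost[OF \<nu>'] by (simp add: less_top cong: measurable_cong_sets add: sets_P)
  have J_nn: "(\<integral>\<^sup>+\<mu>. ennreal (J \<mu>) \<partial>P) = (\<integral>\<^sup>+\<mu>. transport_cost g \<mu> \<nu>' \<partial>P)"
    unfolding J_def using J_fin by (intro nn_integral_cong_AE) (auto elim: eventually_mono)
  have J_nonneg: "0 \<le> J \<mu>" for \<mu> by (simp add: J_def)
  have J_int: "integrable P J"
    using population(2) J_nn by (intro integrableI_nonneg) (auto simp: J_def)
  define \<phi> where "\<phi> t x = (\<integral>\<mu>. g (quantile \<mu> t - x) \<partial>P)" for t x
  have \<phi>_meas [measurable]: "(\<lambda>t. \<phi> t (h t)) \<in> borel_measurable unit_lebesgue"
    if [measurable]: "h \<in> borel_measurable unit_lebesgue" for h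
    unfolding \<phi>_def by measurable
  define S where "S n \<omega> t x = (\<Sum>i<n. g (quantile (Z i \<omega>) t - x)) / real n" for n \<omega> t x
  have good_t: "AE t in unit_lebesgue. AE \<omega> in M. (\<forall>x\<in>\<rat>. (\<lambda>n. S n \<omega> t x) \<longlonglongrightarrow> \<phi> t x) \<and>
      (\<lambda>n. S n \<omega> t (b t)) \<longlonglongrightarrow> \<phi> t (b t)"
    using population(3) AE_space
  proof eventually_elim
    case (elim t)
    then have [measurable]: "(\<lambda>\<mu>. quantile \<mu> t) \<in> borel_measurable weak_borel"
      by (intro measurable_quantile) auto
    have "AE \<omega> in M. (\<lambda>n. S n \<omega> t x) \<longlonglongrightarrow> \<phi> t x" for x
      unfolding S_def \<phi>_def using elim
      by (intro M.strong_law_for_observable[OF indep Z, of "\<lambda>\<mu>. g (quantile \<mu> t - x)"]) auto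
    then show ?case
      by (intro AE_conjI) (auto simp: AE_ball_countable countable_rat)
  qed
  have S_meas [measurable]: "(\<lambda>p. S n (snd p) (fst p) (h (fst p))) \<in> borel_measurable (unit_lebesgue \<Otimes>\<^sub>M M)"
    if [measurable]: "h \<in> borel_measurable unit_lebesgue" for h n
    unfolding S_def by measurable
  have good_\<omega>: "AE \<omega> in M. AE t in unit_lebesgue. (\<forall>x\<in>\<rat>. (\<lambda>n. S n \<omega> t x) \<longlonglongrightarrow> \<phi> t x) \<and>
      (\<lambda>n. S n \<omega> t (b t)) \<longlonglongrightarrow> \<phi> t (b t)"
  proof (rule UM.AE_commute[THEN iffD1, OF _ good_t])
    have "(\<forall>x\<in>\<rat>. (\<lambda>n. S n \<omega> t x) \<longlonglongrightarrow> \<phi> t x) \<longleftrightarrow> (\<forall>r::rat. (\<lambda>n. S n \<omega> t (of_rat r)) \<longlonglongrightarrow> \<phi> t (of_rat r))" for \<omega> t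
      by (auto simp: Rats_def)
    then show "{p \<in> space (unit_lebesgue \<Otimes>\<^sub>M M). (\<forall>x\<in>\<rat>. (\<lambda>n. S n (snd p) (fst p) x) \<longlonglongrightarrow> \<phi> (fst p) x) \<and>
      (\<lambda>n. S n (snd p) (fst p) (b (fst p))) \<longlonglongrightarrow> \<phi> (fst p) (b (fst p))} \<in> sets (unit_lebesgue \<Otimes>\<^sub>M M)"
      by simp
  qed
  have cost_lln: "AE \<omega> in M. (\<lambda>n. (\<Sum>i<n. J (Z i \<omega>)) / n) \<longlonglongrightarrow> (\<integral>\<mu>. J \<mu> \<partial>P)"
    by (rule M.strong_law_for_observable[OF indep Z J_meas J_int])
  have cost_fin: "AE \<omega> in M. \<forall>i. transport_cost g (Z i \<omega>) \<nu>' < \<infinity>"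
    unfolding AE_all_countable
  proof
    fix i
    have "AE \<mu> in distr M weak_borel (Z i). transport_cost g \<mu> \<nu>' < \<infinity>" unfolding Z by (rule J_fin)
    then show "AE \<omega> in M. transport_cost g (Z i \<omega>) \<nu>' < \<infinity>"
      by (rule AE_distrD[OF Z_meas])
  qed
  have limit_cost: "(\<integral>\<^sup>+t. ennreal (\<phi> t (b t)) \<partial>unit_lebesgue) = ennreal (\<integral>\<mu>. J \<mu> \<partial>P)"
  proof -
    have "(\<integral>\<^sup>+t. ennreal (\<phi> t (b t)) \<partial>unit_lebesgue)
        = (\<integral>\<^sup>+t. \<integral>\<^sup>+\<mu>. ennreal (g (quantile \<mu> t - b t)) \<partial>P \<partial>unit_lebesgue)"
      unfolding \<phi>_def using population(3)
      by (intro nn_integral_cong_AE) (auto intro!: nn_integral_eq_integral[symmetric] elim!: eventually_mono)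
    also have "\<dots> = (\<integral>\<^sup>+\<mu>. \<integral>\<^sup>+t. ennreal (g (quantile \<mu> t - b t)) \<partial>unit_lebesgue \<partial>P)"
      by (rule UP.Fubini'[symmetric]) measurable
    also have "\<dots> = (\<integral>\<^sup>+\<mu>. transport_cost g \<mu> \<nu>' \<partial>P)"
      unfolding b_def by (intro nn_integral_cong transport_cost_eq_quantile[symmetric] \<nu>') (simp add: space_P)
    also have "\<dots> = ennreal (\<integral>\<mu>. J \<mu> \<partial>P)"
      unfolding J_nn[symmetric] by (intro nn_integral_eq_integral J_int) (simp add: J_def)
    finally show ?thesis .
  qed
  have \<phi>_nonneg: "0 \<le> \<phi> t x" for t x unfolding \<phi>_def by (intro Bochner_Integration.integral_nonneg) simp
  have limit_int: "integrable unit_lebesgue (\<lambda>t. \<phi> t (b t))"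
    using limit_cost \<phi>_nonneg by (intro integrableI_nonneg) auto
  have limit_cost': "(\<integral>t. \<phi> t (b t) \<partial>unit_lebesgue) = (\<integral>\<mu>. J \<mu> \<partial>P)"
    using limit_cost \<phi>_nonneg limit_int Bochner_Integration.integral_nonneg[of P J, OF J_nonneg]
    by (subst (asm) nn_integral_eq_integral) (auto simp: Bochner_Integration.integral_nonneg)
  show ?thesis
    using good_\<omega> cost_lln cost_fin AE_space unfolding \<nu>'_def[symmetric]
  proof eventually_elim
    case (elim \<omega>)
    have Zp: "Z i \<omega> \<in> borel_probs" for i
      using measurable_space[OF Z_meas elim(4)] by simp
    have Z_quantile [measurable]: "quantile (Z i \<omega>) \<in> borel_measurable unit_lebesgue" for i
      by (rule measurable_quantile1[OF Zp])
    have finite_value: "has_finite_value (\<lambda>\<nu>. \<Sum>i<n. ennreal (1 / real n) * transport_cost g (Z i \<omega>) \<nu>)" for n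
      unfolding has_finite_value_def using elim(3) \<nu>'
      by (intro bexI[of _ \<nu>']) (auto simp: ennreal_mult_less_top less_top)
    have \<nu>p: "\<nu> (Suc n) \<omega> \<in> borel_probs" for n
      unfolding \<nu>_def by (rule finite_barycenter_quantiles(1)[OF _ Zp finite_value]) simp
    define c where "c n = quantile (\<nu> (Suc n) \<omega>)" for n
    have [measurable]: "c n \<in> borel_measurable unit_lebesgue" for n
      unfolding c_def by (rule measurable_quantile1[OF \<nu>p])
    have c_min: "AE t in unit_lebesgue. \<forall>n x. S (Suc n) \<omega> t (c n t) \<le> S (Suc n) \<omega> t x"
      unfolding AE_all_countable S_def c_def \<nu>_def
      by (intro allI finite_barycenter_quantiles(2)[OF _ Zp finite_value]) simp
    have c_lim: "AE t in unit_lebesgue. (\<lambda>n. c n t) \<longlonglongrightarrow> b t"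
      using elim(1) c_min population(3) AE_space
    proof eventually_elim
      case (elim t)
      then have [measurable]: "(\<lambda>\<mu>. quantile \<mu> t) \<in> borel_measurable P"
        by (intro measurable_quantile) auto
      show ?case
      proof (rule strictly_convex_minimizers_converge)
        show "strictly_convex_fun (\<phi> t)"
          unfolding \<phi>_def[abs_def] using elim(3) by (intro strictly_convex_mean_cost[where a="b t"] P) auto
        show "\<phi> t (b t) \<le> \<phi> t x" for x
          using elim(3) unfolding \<phi>_def b_def by blast
        show "\<forall>\<^sub>F n in sequentially. strictly_convex_fun (S (Suc n) \<omega> t)"
          unfolding S_def[abs_def] by (intro always_eventually allI strictly_convex_average_cost) simp
        show "\<forall>\<^sub>F n in sequentially. \<forall>x. S (Suc n) \<omega> t (c n t) \<le> S (Suc n) \<omega> t x"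
          using elim(2) by simp
        show "(\<lambda>n. S (Suc n) \<omega> t x) \<longlonglongrightarrow> \<phi> t x" if "x \<in> \<rat>" for x
          using elim(1) that by (intro LIMSEQ_Suc) blast
      qed
    qed
    \<comment> \<open>The dominating functions, and their limit.\<close>
    define v where "v n t = A + 2 * B * S (Suc n) \<omega> t (b t)" for n t
    define w where "w t = A + 2 * B * \<phi> t (b t)" for t
    have Zi_nn: "(\<integral>\<^sup>+t. ennreal (g (quantile (Z i \<omega>) t - b t)) \<partial>unit_lebesgue) = ennreal (J (Z i \<omega>))" for i
      using elim(3) unfolding J_def b_def
      by (simp add: transport_cost_eq_quantile[OF Zp \<nu>', symmetric])
    have Zi_int: "integrable unit_lebesgue (\<lambda>t. g (quantile (Z i \<omega>) t - b t))" for i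
      using Zi_nn[of i] by (intro integrableI_nonneg) auto
    have Zi: "(\<integral>t. g (quantile (Z i \<omega>) t - b t) \<partial>unit_lebesgue) = J (Z i \<omega>)" for i
      using Zi_nn[of i] Zi_int[of i]
      by (subst (asm) nn_integral_eq_integral) (auto simp: J_def intro!: Bochner_Integration.integral_nonneg)
    have v_int: "integrable unit_lebesgue (v n)" for n
      unfolding v_def[abs_def] S_def using Zi_int by simp
    have w_int: "integrable unit_lebesgue w"
      unfolding w_def[abs_def] using limit_int by simp
    have v_integral: "(\<integral>t. v n t \<partial>unit_lebesgue) = A + 2 * B * ((\<Sum>i<Suc n. J (Z i \<omega>)) / Suc n)" for n
      unfolding v_def S_def using Zi_int by (simp add: Zi unit_mass del: sum.lessThan_Suc of_nat_Suc)
    have w_integral: "(\<integral>t. w t \<partial>unit_lebesgue) = A + 2 * B * (\<integral>\<mu>. J \<mu> \<partial>P)"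
      unfolding w_def using limit_int by (simp add: limit_cost' unit_mass)
    have v_integral_lim: "(\<lambda>n. \<integral>t. v n t \<partial>unit_lebesgue) \<longlonglongrightarrow> (\<integral>t. w t \<partial>unit_lebesgue)"
      unfolding v_integral w_integral using LIMSEQ_Suc[OF elim(2)] by (intro tendsto_intros)
    have v_lim: "AE t in unit_lebesgue. (\<lambda>n. v n t) \<longlonglongrightarrow> w t"
      using elim(1)
    proof eventually_elim
      case (elim t)
      then show ?case
        unfolding v_def w_def using LIMSEQ_Suc[of "\<lambda>n. S n \<omega> t (b t)"] by (intro tendsto_intros) auto
    qed
    have g_lim: "(\<lambda>n. g (y n)) \<longlonglongrightarrow> 0" if "y \<longlonglongrightarrow> 0" for y
      using continuous_on_tendsto_compose[OF strictly_convex_fun_continuous[OF strictly_convex] that] by simp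
    have "(\<lambda>n. \<integral>\<^sup>+t. ennreal (g (c n t - b t)) \<partial>unit_lebesgue) \<longlonglongrightarrow> 0"
    proof (rule nn_integral_tendsto_0_if_dominated[OF _ v_int w_int _ _ v_lim v_integral_lim])
      show "AE t in unit_lebesgue. \<forall>n. 0 \<le> g (c n t - b t) \<and> g (c n t - b t) \<le> v n t"
        using c_min
      proof eventually_elim
        case (elim t)
        then show ?case
          unfolding v_def S_def using distance_to_average_minimizer_le(1) by (metis g_nonneg zero_less_Suc)
      qed
      show "AE t in unit_lebesgue. (\<lambda>n. g (c n t - b t)) \<longlonglongrightarrow> 0"
        using c_lim by eventually_elim (intro g_lim LIM_zero)
    qed measurable
    moreover have "(\<lambda>n. \<integral>\<^sup>+t. ennreal (g (b t - c n t)) \<partial>unit_lebesgue) \<longlonglongrightarrow> 0"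
    proof (rule nn_integral_tendsto_0_if_dominated[OF _ v_int w_int _ _ v_lim v_integral_lim])
      show "AE t in unit_lebesgue. \<forall>n. 0 \<le> g (b t - c n t) \<and> g (b t - c n t) \<le> v n t"
        using c_min
      proof eventually_elim
        case (elim t)
        then show ?case
          unfolding v_def S_def using distance_to_average_minimizer_le(2) by (metis g_nonneg zero_less_Suc)
      qed
      show "AE t in unit_lebesgue. (\<lambda>n. g (b t - c n t)) \<longlonglongrightarrow> 0"
        using c_lim
      proof eventually_elim
        case (elim t)
        then show ?case using tendsto_diff[OF tendsto_const[of "b t"] elim] by (intro g_lim) simp
      qed
    qed measurable
    ultimately show ?case
      unfolding transport_cost_eq_quantile[OF \<nu>p \<nu>'] transport_cost_eq_quantile[OF \<nu>' \<nu>p] b_def c_def ..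
  qed
qed

end

theorem theorem6:
  fixes g :: "real \<Rightarrow> real" and A B :: real
    and P :: "real measure measure"
    and M :: "'w measure" and \<mu> :: "nat \<Rightarrow> 'w \<Rightarrow> real measure"
  assumes convex: "strictly_convex_fun g"
    and minimum: "\<forall>x. g 0 \<le> g x" and zero: "g 0 = 0"
    and nonneg: "A \<ge> 0" "B \<ge> 0"
    and growth: "\<forall>x y. g (x - y) \<le> A + B * (g x + g y)"
    and P: "prob_space P" "sets P = sets weak_borel"
    and M: "prob_space M"
    and indep: "prob_space.indep_vars M (\<lambda>_. weak_borel) \<mu> {1..}"
    and distr: "\<forall>i\<ge>1. distr M weak_borel (\<mu> i) = P"
    and ex: "bar_exists g P"
  shows "AE \<omega> in M.
      (\<lambda>n. transport_cost g (finite_bar g n (\<lambda>i. \<mu> i \<omega>) (\<lambda>_. 1 / real n)) (bar g P))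
        \<longlonglongrightarrow> 0 \<and>
      (\<lambda>n. transport_cost g (bar g P) (finite_bar g n (\<lambda>i. \<mu> i \<omega>) (\<lambda>_. 1 / real n)))
        \<longlonglongrightarrow> 0"
proof -
  interpret quasi_metric_cost g A B
    using convex minimum zero nonneg growth by unfold_locales auto
  interpret M: prob_space M by (rule M)
  have "range Suc = {1..}" by (auto simp: image_iff Suc_le_eq gr0_conv_Suc)
  then have indep': "M.indep_vars (\<lambda>_. weak_borel) (\<lambda>i. \<mu> (Suc i)) UNIV"
    using M.indep_vars_reindex[of Suc UNIV "\<lambda>_. weak_borel" \<mu>] indep by simp
  have bar: "finite_bar g n (\<lambda>i. \<mu> i \<omega>) (\<lambda>_. 1 / real n)
      = minimizer (\<lambda>\<nu>. \<Sum>i<n. ennreal (1 / real n) * transport_cost g (\<mu> (Suc i) \<omega>) \<nu>)" for n \<omega>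
    unfolding finite_bar_def by (simp add: sum.atLeast1_atMost_eq)
  have "AE \<omega> in M.
      (\<lambda>n. transport_cost g (finite_bar g (Suc n) (\<lambda>i. \<mu> i \<omega>) (\<lambda>_. 1 / real (Suc n))) (bar g P)) \<longlonglongrightarrow> 0 \<and>
      (\<lambda>n. transport_cost g (bar g P) (finite_bar g (Suc n) (\<lambda>i. \<mu> i \<omega>) (\<lambda>_. 1 / real (Suc n)))) \<longlonglongrightarrow> 0"
    unfolding bar using empirical_barycenters_converge[OF P M indep' _ ex] distr by simp
  then show ?thesis
  proof eventually_elim
    case (elim \<omega>)
    then show ?case
      using LIMSEQ_imp_Suc[of "\<lambda>n. transport_cost g (finite_bar g n (\<lambda>i. \<mu> i \<omega>) (\<lambda>_. 1 / real n)) (bar g P)" 0]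
        LIMSEQ_imp_Suc[of "\<lambda>n. transport_cost g (bar g P) (finite_bar g n (\<lambda>i. \<mu> i \<omega>) (\<lambda>_. 1 / real n))" 0]
      by blast
  qed
qed

end
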